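(* Let $G=([n],E)$ be a chordal graph whose ordering $1,\ldots,n$ is a perfect elimination ordering, and consider the sequence of elimination forests for $G$ visited by Algorithm R started from $F_0$. Here $F_0$ is the forest obtained by removing vertices in the order $1,\ldots,n$. If $G$ is 2-connected, then the first and the last forest of this sequence differ by a single tree rotation (the Gray code is cyclic). On the other hand, if $G$ is a tree with at least four vertices, then the first and last forest of this sequence do not differ by a single tree rotation.
   Context: A graph is 2-connected if it has at least three vertices and removing any single vertex leaves a connected graph. For a graph $G$ and a vertex set $X$, $G-X$ is the graph obtained by deleting $X$. An elimination tree for a connected graph $G$ is a rooted tree on its vertex set consisting of a root $x$ whose children are the roots of elimination trees for the connected components of $G-x$ (unordered). An elimination forest is one elimination tree per component. Removing vertices in an order determines an elimination forest. A perfect elimination ordering is an ordering $1,\ldots,n$ in which each vertex $v$ forms a clique with its neighbors smaller than $v$. Rotation of a tree edge $\{i,j\}$, where $i$ is the parent of $j$: let $H$ be the subgraph induced by the subtree rooted at $i$. Then $j$ takes $i$'s place, $i$ becomes a child of $j$, subtrees of $i$ stay with $i$, and each subtree $S$ of $j$ stays with $j$ unless $S$ lies in the same component of $H-j$ as $i$, in which case it moves to $i$. An up-rotation of $j$ rotates the edge to its parent $i$ with $i<j$. A down-rotation of $j$ rotates an edge to a child $i<j$. Algorithm R: visit $F_0$. Then repeatedly, in the last visited forest, take the largest vertex $j$ admitting an up- or down-rotation that leads to an unvisited forest. Terminate if none exists, or if more than one edge $\{i,j\}$ with $i<j$ leads to an unvisited forest. Otherwise perform that rotation and visit the result. (For such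 $G$, Algorithm R visits every elimination forest exactly once.) *)

theory Defs
  imports Main
begin

section \<open>Simple graphs\<close>

definition simple_graph :: "nat set \<Rightarrow> nat set set \<Rightarrow> bool" where
  "simple_graph V E \<longleftrightarrow> finite V \<and> (\<forall>e\<in>E. e \<subseteq> V \<and> card e = 2)"

definition edges_on :: "nat set set \<Rightarrow> nat set \<Rightarrow> (nat \<times> nat) set" where
  "edges_on E X = {(u, v). u \<in> X \<and> v \<in> X \<and> {u, v} \<in> E}"

text \<open>All of the following notions refer to the subgraph of the graph \<open>E\<close> induced by a vertex
  set \<open>X\<close>; deleting vertices means passing to a smaller \<open>X\<close>.\<close>

definition connected_on :: "nat set set \<Rightarrow> nat set \<Rightarrow> bool" where
  "connected_on E X \<longleftrightarrow> X \<noteq> {} \<and> (\<forall>u\<in>X. \<forall>v\<in>X. (u, v) \<in> (edges_on E X)\<^sup>*)"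

definition component :: "nat set set \<Rightarrow> nat set \<Rightarrow> nat \<Rightarrow> nat set" where
  "component E X v = {u \<in> X. (v, u) \<in> (edges_on E X)\<^sup>*}"

definition components :: "nat set set \<Rightarrow> nat set \<Rightarrow> nat set set" where
  "components E X = component E X ` X"

definition two_connected :: "nat set \<Rightarrow> nat set set \<Rightarrow> bool" where
  "two_connected V E \<longleftrightarrow> card V \<ge> 3 \<and> (\<forall>v\<in>V. connected_on E (V - {v}))"

definition cycle :: "nat set set \<Rightarrow> nat list \<Rightarrow> bool" where
  "cycle E cs \<longleftrightarrow> length cs \<ge> 3 \<and> distinct cs \<and>
     (\<forall>k<length cs. {cs ! k, cs ! (Suc k mod length cs)} \<in> E)"

definition tree :: "nat set \<Rightarrow> nat set set \<Rightarrow> bool" where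
  "tree V E \<longleftrightarrow> connected_on E V \<and> (\<nexists>cs. cycle E cs)"

definition chordal :: "nat set set \<Rightarrow> bool" where
  "chordal E \<longleftrightarrow> (\<forall>cs. cycle E cs \<and> length cs \<ge> 4 \<longrightarrow>
     (\<exists>a<length cs. \<exists>b<length cs. {cs ! a, cs ! b} \<in> E \<and>
        b \<noteq> Suc a mod length cs \<and> a \<noteq> Suc b mod length cs))"

definition clique :: "nat set set \<Rightarrow> nat set \<Rightarrow> bool" where
  "clique E K \<longleftrightarrow> (\<forall>u\<in>K. \<forall>v\<in>K. u \<noteq> v \<longrightarrow> {u, v} \<in> E)"

definition perfect_elimination_ordering :: "nat \<Rightarrow> nat set set \<Rightarrow> bool" where
  "perfect_elimination_ordering n E \<longleftrightarrow>
     (\<forall>v\<in>{1..n}. clique E (insert v {u \<in> {1..n}. u < v \<and> {u, v} \<in> E}))"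


section \<open>Elimination forests\<close>

text \<open>A rooted forest with unordered children is given by its parent map; roots, and numbers that
  are not vertices of the forest, are mapped to \<open>None\<close>.\<close>

type_synonym forest = "nat \<Rightarrow> nat option"

text \<open>\<open>elim_tree E C x p\<close>: on the vertices of \<open>C\<close> other than \<open>x\<close>, \<open>p\<close> is the parent map of an
  elimination tree with root \<open>x\<close> of the subgraph induced by \<open>C\<close>. The value of \<open>p\<close> at the root is
  left open, since the tree may hang below another vertex.\<close>

inductive elim_tree :: "nat set set \<Rightarrow> nat set \<Rightarrow> nat \<Rightarrow> forest \<Rightarrow> bool" for E where
  "\<lbrakk>connected_on E C; x \<in> C;
    \<forall>D\<in>components E (C - {x}). \<exists>r. elim_tree E D r p \<and> p r = Some x\<rbrakk>
   \<Longrightarrow> elim_tree E C x p"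

definition elim_forest :: "nat set set \<Rightarrow> nat set \<Rightarrow> forest \<Rightarrow> bool" where
  "elim_forest E V p \<longleftrightarrow>
     (\<forall>C\<in>components E V. \<exists>r. elim_tree E C r p \<and> p r = None) \<and> (\<forall>v. v \<notin> V \<longrightarrow> p v = None)"

text \<open>The forest obtained by removing the vertices in the order of the list: the first vertex
  becomes the root of its component \<open>C\<close>, and the roots of the trees on \<open>C - {x}\<close> that arise from
  the remaining removals become its children.\<close>

fun forest_of_order :: "nat set set \<Rightarrow> nat set \<Rightarrow> nat list \<Rightarrow> forest" where
  "forest_of_order E X [] = (\<lambda>v. None)"
| "forest_of_order E X (x # xs) =
     (let p = forest_of_order E (X - {x}) xs
      in (\<lambda>v. if v \<in> component E X x - {x} \<and> p v = None then Some x else p v))"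

definition initial_forest :: "nat \<Rightarrow> nat set set \<Rightarrow> forest" where
  "initial_forest n E = forest_of_order E {1..n} [1..<Suc n]"

definition subtree :: "forest \<Rightarrow> nat \<Rightarrow> nat set" where
  "subtree p i = {v. (v, i) \<in> {(a, b). p a = Some b}\<^sup>*}"


section \<open>Tree rotations\<close>

text \<open>Rotation of the edge between \<open>i\<close> and its child \<open>j\<close>; here \<open>v\<close> is the root of the subtree
  \<open>S\<close> of \<open>j\<close>.\<close>

definition rotate_edge :: "nat set set \<Rightarrow> forest \<Rightarrow> nat \<Rightarrow> nat \<Rightarrow> forest" where
  "rotate_edge E p i j = (\<lambda>v.
     if v = j then p i
     else if v = i then Some j
     else if p v = Some j \<and> subtree p v \<subseteq> component E (subtree p i - {j}) i then Some i
     else p v)"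

definition differ_by_rotation :: "nat set set \<Rightarrow> forest \<Rightarrow> forest \<Rightarrow> bool" where
  "differ_by_rotation E p q \<longleftrightarrow> (\<exists>i j. p j = Some i \<and> q = rotate_edge E p i j)"

text \<open>Up- and down-rotation of \<open>j\<close> at the edge \<open>{i, j}\<close>, transforming \<open>p\<close> into \<open>q\<close>.\<close>

definition up_rotation :: "nat set set \<Rightarrow> forest \<Rightarrow> nat \<Rightarrow> nat \<Rightarrow> forest \<Rightarrow> bool" where
  "up_rotation E p i j q \<longleftrightarrow> i < j \<and> p j = Some i \<and> q = rotate_edge E p i j"

definition down_rotation :: "nat set set \<Rightarrow> forest \<Rightarrow> nat \<Rightarrow> nat \<Rightarrow> forest \<Rightarrow> bool" where
  "down_rotation E p i j q \<longleftrightarrow> i < j \<and> p i = Some j \<and> q = rotate_edge E p j i"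


section \<open>Algorithm R\<close>

text \<open>The list \<open>Fs\<close> holds the forests visited so far, in order. The edges \<open>{i, j}\<close> with \<open>i < j\<close>
  of the last visited forest whose rotation leads to an unvisited forest are represented by their
  smaller endpoints \<open>i\<close>.\<close>

definition new_move :: "nat set set \<Rightarrow> forest list \<Rightarrow> nat \<Rightarrow> nat \<Rightarrow> forest \<Rightarrow> bool" where
  "new_move E Fs i j q \<longleftrightarrow>
     (up_rotation E (last Fs) i j q \<or> down_rotation E (last Fs) i j q) \<and> q \<notin> set Fs"

definition new_edges :: "nat set set \<Rightarrow> forest list \<Rightarrow> nat \<Rightarrow> nat set" where
  "new_edges E Fs j = {i. \<exists>q. new_move E Fs i j q}"

definition algR_step :: "nat set set \<Rightarrow> forest list \<Rightarrow> forest \<Rightarrow> bool" where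
  "algR_step E Fs q \<longleftrightarrow>
     (\<exists>j i. (\<forall>k>j. new_edges E Fs k = {}) \<and> new_edges E Fs j = {i} \<and> new_move E Fs i j q)"

inductive algR_visits :: "nat \<Rightarrow> nat set set \<Rightarrow> forest list \<Rightarrow> bool" for n E where
  init: "algR_visits n E [initial_forest n E]"
| step: "\<lbrakk>algR_visits n E Fs; algR_step E Fs q\<rbrakk> \<Longrightarrow> algR_visits n E (Fs @ [q])"

definition algR_sequence :: "nat \<Rightarrow> nat set set \<Rightarrow> forest list \<Rightarrow> bool" where
  "algR_sequence n E Fs \<longleftrightarrow> algR_visits n E Fs \<and> (\<nexists>q. algR_step E Fs q)"


section \<open>Components\<close>

lemma sym_edges_on: "sym (edges_on E X)"
  by (auto simp: edges_on_def sym_def insert_commute)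

lemma edges_on_sym_star: "(u, v) \<in> (edges_on E X)\<^sup>* \<Longrightarrow> (v, u) \<in> (edges_on E X)\<^sup>*"
  using sym_rtrancl[OF sym_edges_on] by (meson symD)

lemma conn_sub:
  assumes S: "connected_on E S" "S \<subseteq> X" and D: "\<forall>u\<in>D. \<forall>v\<in>X - D. {u, v} \<notin> E"
    and m: "S \<inter> D \<noteq> {}"
  shows "S \<subseteq> D"
proof
  fix v assume v: "v \<in> S"
  from m obtain u where u: "u \<in> S" "u \<in> D" by blast
  have "(u, v) \<in> (edges_on E S)\<^sup>*" using S u v by (auto simp: connected_on_def)
  then show "v \<in> D"
  proof (induction rule: rtrancl_induct)
    case (step y z)
    then show ?case using D S(2) by (auto simp: edges_on_def)
  qed (use u in simp)
qed

lemma components_iff: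
  "C \<in> components E X \<longleftrightarrow> C \<subseteq> X \<and> connected_on E C \<and> (\<forall>u\<in>C. \<forall>v\<in>X - C. {u, v} \<notin> E)"
proof
  assume "C \<in> components E X"
  then obtain w where w: "w \<in> X" "C = component E X w" by (auto simp: components_def)
  have sub: "C \<subseteq> X" using w by (auto simp: component_def)
  have cl: "\<forall>u\<in>C. \<forall>v\<in>X - C. {u, v} \<notin> E"
  proof (intro ballI notI)
    fix u v assume a: "u \<in> C" "v \<in> X - C" "{u, v} \<in> E"
    then have "(w, u) \<in> (edges_on E X)\<^sup>*" "(u, v) \<in> edges_on E X"
      using w by (auto simp: component_def edges_on_def)
    then have "(w, v) \<in> (edges_on E X)\<^sup>*" by (rule rtrancl_into_rtrancl)
    then show False using a w by (auto simp: component_def)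
  qed
  have wC: "w \<in> C" using w by (auto simp: component_def)
  have "(w, u) \<in> (edges_on E C)\<^sup>* \<and> u \<in> C" if "(w, u) \<in> (edges_on E X)\<^sup>*" for u
    using that
  proof (induction rule: rtrancl_induct)
    case base then show ?case using wC by simp
  next
    case (step y z)
    have "z \<in> C" using step cl by (auto simp: edges_on_def)
    moreover have "(y, z) \<in> edges_on E C" using step \<open>z \<in> C\<close> by (auto simp: edges_on_def)
    ultimately show ?case using step by (meson rtrancl_into_rtrancl)
  qed
  then have "(w, u) \<in> (edges_on E C)\<^sup>*" if "u \<in> C" for u
    using that w by (auto simp: component_def)
  then have "connected_on E C"
    unfolding connected_on_def using wC by (metis edges_on_sym_star empty_iff rtrancl_trans)
  then show "C \<subseteq> X \<and> connected_on E C \<and> (\<forall>u\<in>C. \<forall>v\<in>X - C. {u, v} \<notin> E)"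
    using sub cl by blast
next
  assume a: "C \<subseteq> X \<and> connected_on E C \<and> (\<forall>u\<in>C. \<forall>v\<in>X - C. {u, v} \<notin> E)"
  then obtain w where w: "w \<in> C" by (auto simp: connected_on_def)
  have "edges_on E C \<subseteq> edges_on E X" using a by (auto simp: edges_on_def)
  then have "C \<subseteq> component E X w"
    using a w rtrancl_mono[of "edges_on E C" "edges_on E X"]
    by (auto simp: connected_on_def component_def)
  moreover have "u \<in> C" if "(w, u) \<in> (edges_on E X)\<^sup>*" for u
    using that
  proof (induction rule: rtrancl_induct)
    case (step y z)
    then show ?case using a by (auto simp: edges_on_def)
  qed (use w in simp)
  ultimately have "C = component E X w" by (auto simp: component_def)
  then show "C \<in> components E X" using w a by (auto simp: components_def)
qed

lemma component_in: "v \<in> X \<Longrightarrow> component E X v \<in> components E X" "v \<in> X \<Longrightarrow> v \<in> component E X v"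
  by (auto simp: components_def component_def)

lemma component_subset_components:
  "\<lbrakk>connected_on E S; S \<subseteq> X; D \<in> components E X; S \<inter> D \<noteq> {}\<rbrakk> \<Longrightarrow> S \<subseteq> D"
  by (rule conn_sub[of E S X D]) (auto simp: components_iff)

lemma components_eq:
  assumes "C \<in> components E X" "D \<in> components E X" "v \<in> C" "v \<in> D" shows "C = D"
proof -
  have "C \<subseteq> D" using assms by (intro component_subset_components[of E C X D]) (auto simp: components_iff)
  moreover have "D \<subseteq> C"
    using assms by (intro component_subset_components[of E D X C]) (auto simp: components_iff)
  ultimately show ?thesis by blast
qed

lemma components_adjacent:
  assumes "connected_on E C" "i \<in> C" "D \<in> components E (C - {i})"
  shows "\<exists>u\<in>D. {u, i} \<in> E"
proof (rule ccontr)
  assume "\<not> ?thesis"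
  then have "D \<in> components E C" using assms by (auto simp: components_iff)
  moreover have "D \<subseteq> C - {i}" "D \<noteq> {}" using assms by (auto simp: components_iff connected_on_def)
  ultimately have "C \<subseteq> D" using assms by (intro component_subset_components[of E C C D]) auto
  then show False using assms \<open>D \<subseteq> C - {i}\<close> by blast
qed


section \<open>Every visited forest is an elimination forest\<close>

lemma elim_tree_subset: "elim_tree E C x p \<Longrightarrow> x \<in> C \<and> connected_on E C"
  by (auto elim: elim_tree.cases)

lemma elim_tree_cong:
  "\<lbrakk>elim_tree E C x p; \<And>v. v \<in> C - {x} \<Longrightarrow> q v = p v\<rbrakk> \<Longrightarrow> elim_tree E C x q"
proof (induction rule: elim_tree.induct)
  case (1 C x p)
  show ?case
  proof (rule elim_tree.intros[OF 1(1,2)], rule ballI)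
    fix D assume D: "D \<in> components E (C - {x})"
    then obtain r where r: "elim_tree E D r p" "p r = Some x"
      "(\<And>v. v \<in> D - {r} \<Longrightarrow> q v = p v) \<Longrightarrow> elim_tree E D r q" using 1(3) by blast
    have "D \<subseteq> C - {x}" using D by (auto simp: components_iff)
    moreover have "r \<in> D" using r elim_tree_subset by blast
    ultimately show "\<exists>r. elim_tree E D r q \<and> q r = Some x"
      using r 1(4) by (intro exI[of _ r]) (auto simp: subset_iff)
  qed
qed

lemma elim_tree_parent:
  "\<lbrakk>elim_tree E C x p; v \<in> C; v \<noteq> x\<rbrakk> \<Longrightarrow> \<exists>w\<in>C. p v = Some w"
proof (induction rule: elim_tree.induct)
  case (1 C x p)
  let ?D = "component E (C - {x}) v"
  have D: "?D \<in> components E (C - {x})" "v \<in> ?D" using component_in[of v "C - {x}"] 1 by auto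
  then obtain r where r: "p r = Some x" "v \<in> ?D \<longrightarrow> v \<noteq> r \<longrightarrow> (\<exists>w\<in>?D. p v = Some w)"
    using 1(3) by blast
  have "?D \<subseteq> C" by (auto simp: component_def)
  then show ?case using r D 1(2) by (cases "v = r") auto
qed

definition closed_tree :: "forest \<Rightarrow> nat set \<Rightarrow> nat \<Rightarrow> bool" where
  "closed_tree p C x \<longleftrightarrow> (\<forall>v. \<forall>w\<in>C. p v = Some w \<longrightarrow> v \<in> C - {x})"

lemma closed_tree_child:
  assumes C: "elim_tree E C x p" "closed_tree p C x"
    and D: "D \<in> components E (C - {x})" "elim_tree E D r p" "p r = Some x"
  shows "closed_tree p D r"
  unfolding closed_tree_def
proof (intro allI ballI impI)
  fix v w assume w: "w \<in> D" "p v = Some w"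
  have DC: "D \<subseteq> C - {x}" using D by (auto simp: components_iff)
  have v: "v \<in> C - {x}" using C(2) w DC by (auto simp: closed_tree_def)
  let ?D = "component E (C - {x}) v"
  have D': "?D \<in> components E (C - {x})" "v \<in> ?D" using component_in v by auto
  then obtain r' where r': "elim_tree E ?D r' p" "p r' = Some x"
    using C(1) by (auto elim: elim_tree.cases)
  have "v \<noteq> r'" using r' w DC by auto
  then have "w \<in> ?D" using elim_tree_parent[OF r'(1) D'(2)] w by auto
  then have "?D = D" using components_eq[OF D'(1) D(1)] w by blast
  then show "v \<in> D - {r}" using D'(2) D(3) w DC by auto
qed

lemma subtree_subset:
  assumes "closed_tree p C x" "i \<in> C" shows "subtree p i \<subseteq> C"
proof
  fix v assume "v \<in> subtree p i"
  then have "(v, i) \<in> {(a, b). p a = Some b}\<^sup>*" by (simp add: subtree_def)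
  then show "v \<in> C"
  proof (induction rule: converse_rtrancl_induct)
    case (step y z)
    then show ?case using assms(1) by (auto simp: closed_tree_def)
  qed (rule assms)
qed

lemma elim_tree_subtree:
  "elim_tree E C x p \<Longrightarrow> C \<subseteq> subtree p x"
proof (induction rule: elim_tree.induct)
  case (1 C x p)
  show ?case
  proof
    fix v assume v: "v \<in> C"
    show "v \<in> subtree p x"
    proof (cases "v = x")
      case True then show ?thesis by (simp add: subtree_def)
    next
      case False
      let ?D = "component E (C - {x}) v"
      have D: "?D \<in> components E (C - {x})" "v \<in> ?D"
        using component_in[of v "C - {x}"] v False by auto
      then obtain r where r: "p r = Some x" "?D \<subseteq> subtree p r" using 1(3) by blast
      then have "(v, r) \<in> {(a, b). p a = Some b}\<^sup>*" using D by (auto simp: subtree_def)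
      moreover have "(r, x) \<in> {(a, b). p a = Some b}" using r by simp
      ultimately have "(v, x) \<in> {(a, b). p a = Some b}\<^sup>*" by (rule rtrancl_into_rtrancl)
      then show ?thesis by (simp add: subtree_def)
    qed
  qed
qed

lemma subtree_eq: "\<lbrakk>elim_tree E C x p; closed_tree p C x\<rbrakk> \<Longrightarrow> subtree p x = C"
  using subtree_subset[of p C x x] elim_tree_subtree[of E C x p] elim_tree_subset[of E C x p] by blast

lemma rotate_root:
  assumes C: "elim_tree E C i p" "closed_tree p C i" and ji: "p j = Some i"
  shows "elim_tree E C j (rotate_edge E p i j)"
proof -
  let ?q = "rotate_edge E p i j"
  define K where "K = component E (C - {j}) i"
  have iC: "i \<in> C" and conC: "connected_on E C" using elim_tree_subset[OF C(1)] by auto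
  have jC: "j \<in> C" "j \<noteq> i" using C(2) ji iC by (auto simp: closed_tree_def)
  have st: "subtree p i = C" by (rule subtree_eq[OF C])
  have K: "K \<in> components E (C - {j})" "i \<in> K"
    using component_in[of i "C - {j}"] iC jC by (auto simp: K_def)
  have Ksub: "K \<subseteq> C - {j}" and Kcon: "connected_on E K"
    and Kcl: "\<And>u v. u \<in> K \<Longrightarrow> v \<in> C - {j} \<Longrightarrow> {u, v} \<in> E \<Longrightarrow> v \<in> K"
    using K(1) by (auto simp: components_iff)
  have q: "?q v = (if v = j then p i else if v = i then Some j
      else if p v = Some j \<and> subtree p v \<subseteq> K then Some i else p v)" for v
    by (simp add: rotate_edge_def st K_def)
  have kids: "\<exists>r. elim_tree E D r p \<and> p r = Some i" if "D \<in> components E (C - {i})" for D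
    using C(1) that by (auto elim: elim_tree.cases)
  define J where "J = component E (C - {i}) j"
  have J: "J \<in> components E (C - {i})" "j \<in> J"
    using component_in[of j "C - {i}"] jC by (auto simp: J_def)
  have Jsub: "J \<subseteq> C - {i}" and Jcl: "\<And>u v. u \<in> J \<Longrightarrow> v \<in> C - {i} \<Longrightarrow> {u, v} \<in> E \<Longrightarrow> v \<in> J"
    using J(1) by (auto simp: components_iff)
  obtain r0 where r0: "elim_tree E J r0 p" "p r0 = Some i" using kids[OF J(1)] by blast
  have "r0 = j"
    using elim_tree_parent[OF r0(1) J(2)] ji Jsub by auto
  then have Jt: "elim_tree E J j p" using r0 by simp
  have Jclosed: "closed_tree p J j" by (rule closed_tree_child[OF C J(1) Jt ji])
  have kidsJ: "\<exists>r. elim_tree E S r p \<and> p r = Some j \<and> subtree p r = S"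
    if "S \<in> components E (J - {j})" for S
  proof -
    obtain r where r: "elim_tree E S r p" "p r = Some j"
      using Jt \<open>S \<in> _\<close> by (auto elim: elim_tree.cases)
    then show ?thesis using subtree_eq[OF r(1) closed_tree_child[OF Jt Jclosed \<open>S \<in> _\<close> r]] by blast
  qed
  have other: "D \<subseteq> K \<and> j \<notin> D" if D: "D \<in> components E (C - {i})" "D \<noteq> J" for D
  proof -
    have jD: "j \<notin> D" using components_eq[OF D(1) J(1)] J(2) D(2) by blast
    have Ds: "D \<subseteq> C - {j}" and Dc: "connected_on E D" using D jD by (auto simp: components_iff)
    obtain u where u: "u \<in> D" "{u, i} \<in> E" using components_adjacent[OF conC iC D(1)] by blast
    have "u \<in> K" using Kcl[OF K(2), of u] u Ds by (auto simp: insert_commute)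
    then have "D \<subseteq> K" using component_subset_components[OF Dc Ds K(1)] u by blast
    then show ?thesis using jD by blast
  qed
  have main: "\<exists>r. elim_tree E D r ?q \<and> ?q r = Some j" if D: "D \<in> components E (C - {j})" for D
  proof (cases "i \<in> D")
    case False
    have Dp: "D \<subseteq> C - {j}" "connected_on E D" "\<And>u v. u \<in> D \<Longrightarrow> v \<in> C - {j} \<Longrightarrow> {u, v} \<in> E \<Longrightarrow> v \<in> D"
      using D by (auto simp: components_iff)
    have DK: "D \<inter> K = {}" using components_eq[OF D K(1)] K(2) False by blast
    have DJ: "D \<subseteq> J"
    proof
      fix v assume v: "v \<in> D"
      let ?D = "component E (C - {i}) v"
      have "v \<in> C - {i}" using v Dp False by auto
      then have "?D \<in> components E (C - {i})" "v \<in> ?D" using component_in by auto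
      then show "v \<in> J" using other[of ?D] DK v by blast
    qed
    have "D \<in> components E (J - {j})"
      unfolding components_iff using Dp DJ Jsub by blast
    then obtain r where r: "elim_tree E D r p" "p r = Some j" "subtree p r = D" using kidsJ by blast
    have rD: "r \<in> D" using elim_tree_subset[OF r(1)] by simp
    have "?q r = Some j" using r rD DK Dp False by (auto simp: q)
    moreover have "?q v = p v" if "v \<in> D - {r}" for v
    proof -
      have "p v \<noteq> Some j" using elim_tree_parent[OF r(1), of v] that Dp by auto
      then show ?thesis using that Dp False by (auto simp: q)
    qed
    ultimately show ?thesis using elim_tree_cong[OF r(1)] by blast
  next
    case True
    then have DK: "D = K" using components_eq[OF D K(1) _ K(2)] by blast
    have "elim_tree E K i ?q"
    proof (rule elim_tree.intros[OF Kcon K(2)], rule ballI)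
      fix S assume S: "S \<in> components E (K - {i})"
      then have Sp: "S \<subseteq> K - {i}" "connected_on E S" "S \<noteq> {}"
        "\<And>u v. u \<in> S \<Longrightarrow> v \<in> K - {i} \<Longrightarrow> {u, v} \<in> E \<Longrightarrow> v \<in> S"
        by (auto simp: components_iff connected_on_def)
      obtain s where s: "s \<in> S" using Sp by blast
      define B where "B = component E (C - {i}) s"
      have "s \<in> C - {i}" using s Sp(1) Ksub by blast
      then have B: "B \<in> components E (C - {i})" "s \<in> B"
        unfolding B_def by (simp_all add: component_in)
      have SB: "S \<subseteq> B"
        using component_subset_components[OF Sp(2) _ B(1)] Sp Ksub s B by blast
      show "\<exists>r. elim_tree E S r ?q \<and> ?q r = Some i"
      proof (cases "B = J")
        case False
        have "B \<subseteq> K - {i}" using other[OF B(1) False] B(1) by (auto simp: components_iff)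
        moreover have "connected_on E B" using B(1) by (simp add: components_iff)
        ultimately have "B \<subseteq> S" using component_subset_components[OF _ _ S] s B by blast
        then have SeqB: "S = B" using SB by blast
        obtain r where r: "elim_tree E S r p" "p r = Some i" using kids[OF B(1)] SeqB by blast
        have rS: "r \<in> S" using elim_tree_subset[OF r(1)] by simp
        have jS: "j \<notin> S" "i \<notin> S" using other[OF B(1) False] SeqB Sp by auto
        have "?q v = p v" if "v \<in> S" for v
        proof -
          have "p v \<noteq> Some j"
            using elim_tree_parent[OF r(1) that] r(2) jS jC by (cases "v = r") auto
          then show ?thesis using that jS by (auto simp: q)
        qed
        then show ?thesis using elim_tree_cong[OF r(1)] r(2) rS by (metis DiffD1)
      next
        case True
        have "S \<in> components E (J - {j})"
          unfolding components_iff
        proof (intro conjI ballI notI)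
          show "S \<subseteq> J - {j}" using SB True Sp Ksub by blast
          show "connected_on E S" by (rule Sp)
          fix u v assume uv: "u \<in> S" "v \<in> J - {j} - S" "{u, v} \<in> E"
          have "v \<in> K" using Kcl[of u v] uv Sp(1) Jsub by blast
          then show False using Sp(4)[of u v] uv Jsub by blast
        qed
        then obtain r where r: "elim_tree E S r p" "p r = Some j" "subtree p r = S"
          using kidsJ by blast
        have rS: "r \<in> S" using elim_tree_subset[OF r(1)] by simp
        have jS: "j \<notin> S" "i \<notin> S" using Sp Ksub by auto
        have "?q r = Some i" using r rS jS Sp by (auto simp: q)
        moreover have "?q v = p v" if "v \<in> S - {r}" for v
        proof -
          have "p v \<noteq> Some j" using elim_tree_parent[OF r(1), of v] that jS by auto
          then show ?thesis using that jS by (auto simp: q)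
        qed
        ultimately show ?thesis using elim_tree_cong[OF r(1)] by blast
      qed
    qed
    moreover have "?q i = Some j" using jC by (simp add: q)
    ultimately show ?thesis using DK by blast
  qed
  show ?thesis using elim_tree.intros[OF conC jC(1)] main by blast
qed

lemma rotate_outside:
  assumes "v \<notin> subtree p i" "p j = Some i" shows "rotate_edge E p i j v = p v"
proof -
  have i: "i \<in> subtree p i" by (simp add: subtree_def)
  have j: "j \<in> subtree p i" using assms by (auto simp: subtree_def)
  have "p v \<noteq> Some j"
  proof
    assume "p v = Some j"
    then have "v \<in> subtree p i"
      using j by (auto simp: subtree_def intro: converse_rtrancl_into_rtrancl)
    then show False using assms by simp
  qed
  then show ?thesis using i j assms by (auto simp: rotate_edge_def)
qed

lemma rotate_elim_tree:
  "\<lbrakk>elim_tree E C x p; closed_tree p C x; p j = Some i; i \<in> C\<rbrakk>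
   \<Longrightarrow> \<exists>y. elim_tree E C y (rotate_edge E p i j) \<and> rotate_edge E p i j y = p x"
proof (induction rule: elim_tree.induct)
  case (1 C x p)
  let ?q = "rotate_edge E p i j"
  have t: "elim_tree E C x p" using 1 by (intro elim_tree.intros) auto
  show ?case
  proof (cases "x = i")
    case True
    then have "elim_tree E C j ?q" using rotate_root[of E C i p j] t 1 by simp
    moreover have "?q j = p i" by (simp add: rotate_edge_def)
    ultimately show ?thesis using True by blast
  next
    case False
    define B where "B = component E (C - {x}) i"
    have B: "B \<in> components E (C - {x})" "i \<in> B"
      using component_in[of i "C - {x}"] False 1 by (auto simp: B_def)
    obtain r where r: "elim_tree E B r p" "p r = Some x"
      "closed_tree p B r \<Longrightarrow> \<exists>y. elim_tree E B y ?q \<and> ?q y = p r"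
      using 1(3) B 1(5) by blast
    have cB: "closed_tree p B r" by (rule closed_tree_child[OF t 1(4) B(1) r(1,2)])
    have sB: "subtree p i \<subseteq> B" by (rule subtree_subset[OF cB B(2)])
    have out: "?q v = p v" if "v \<notin> B" for v using rotate_outside[of v p i j E] sB that 1 by blast
    have "elim_tree E C x ?q"
    proof (rule elim_tree.intros[OF 1(1,2)], rule ballI)
      fix D assume D: "D \<in> components E (C - {x})"
      show "\<exists>r. elim_tree E D r ?q \<and> ?q r = Some x"
      proof (cases "D = B")
        case True
        then show ?thesis using r cB by auto
      next
        case False
        then have disj: "D \<inter> B = {}" using components_eq[OF D B(1)] by blast
        obtain s where s: "elim_tree E D s p" "p s = Some x" using 1(3) D by blast
        have "elim_tree E D s ?q" using elim_tree_cong[OF s(1), of ?q] out disj by blast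
        moreover have "?q s = Some x" using out[of s] disj s elim_tree_subset[OF s(1)] by auto
        ultimately show ?thesis by blast
      qed
    qed
    moreover have "x \<notin> B" using B(1) by (auto simp: components_iff)
    ultimately show ?thesis using out by blast
  qed
qed

lemma elim_forest_closed:
  assumes F: "elim_forest E V p" and C: "C \<in> components E V" "elim_tree E C r p" "p r = None"
  shows "closed_tree p C r"
  unfolding closed_tree_def
proof (intro allI ballI impI)
  fix v w assume w: "w \<in> C" "p v = Some w"
  have v: "v \<in> V" using F w by (auto simp: elim_forest_def)
  let ?D = "component E V v"
  have D: "?D \<in> components E V" "v \<in> ?D" using component_in v by auto
  then obtain s where s: "elim_tree E ?D s p" "p s = None" using F by (auto simp: elim_forest_def)
  have "v \<noteq> s" using s(2) w by auto
  then have "w \<in> ?D" using elim_tree_parent[OF s(1) D(2)] w by auto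
  then have "?D = C" using components_eq[OF D(1) C(1)] w by blast
  then show "v \<in> C - {r}" using D(2) C(3) w by auto
qed

lemma elim_forest_parent:
  assumes F: "elim_forest E V p" and p: "p v = Some w"
  shows "v \<in> V \<and> w \<in> V"
proof -
  have v: "v \<in> V" using F p by (auto simp: elim_forest_def)
  let ?D = "component E V v"
  have D: "?D \<in> components E V" "v \<in> ?D" using component_in v by auto
  then obtain s where s: "elim_tree E ?D s p" "p s = None" using F by (auto simp: elim_forest_def)
  have "v \<noteq> s" using s(2) p by auto
  then have "w \<in> ?D" using elim_tree_parent[OF s(1) D(2)] p by auto
  then show ?thesis using v by (auto simp: component_def)
qed

theorem rotate_elim_forest:
  assumes F: "elim_forest E V p" and ji: "p j = Some i"
  shows "elim_forest E V (rotate_edge E p i j)"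
proof -
  let ?q = "rotate_edge E p i j"
  have iV: "i \<in> V" using elim_forest_parent[OF F ji] by simp
  define B where "B = component E V i"
  have B: "B \<in> components E V" "i \<in> B" using component_in[of i V] iV by (auto simp: B_def)
  obtain r where r: "elim_tree E B r p" "p r = None" using F B by (auto simp: elim_forest_def)
  have cB: "closed_tree p B r" by (rule elim_forest_closed[OF F B(1) r])
  have sB: "subtree p i \<subseteq> B" by (rule subtree_subset[OF cB B(2)])
  have out: "?q v = p v" if "v \<notin> B" for v using rotate_outside[of v p i j E] sB that ji by blast
  have "\<exists>r. elim_tree E D r ?q \<and> ?q r = None" if D: "D \<in> components E V" for D
  proof (cases "D = B")
    case True
    then show ?thesis using rotate_elim_tree[OF r(1) cB ji B(2)] r(2) by simp
  next
    case False
    then have disj: "D \<inter> B = {}" using components_eq[OF D B(1)] by blast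
    obtain s where s: "elim_tree E D s p" "p s = None" using F D by (auto simp: elim_forest_def)
    have "elim_tree E D s ?q" using elim_tree_cong[OF s(1), of ?q] out disj by blast
    moreover have "?q s = None" using out[of s] disj s elim_tree_subset[OF s(1)] by auto
    ultimately show ?thesis by blast
  qed
  moreover have "?q v = None" if "v \<notin> V" for v
  proof -
    have "B \<subseteq> V" using B(1) by (auto simp: components_iff)
    then show ?thesis using out[of v] that F by (auto simp: elim_forest_def)
  qed
  ultimately show ?thesis by (auto simp: elim_forest_def)
qed

lemma elim_forest_of_order:
  "\<lbrakk>distinct xs; set xs = X\<rbrakk> \<Longrightarrow> elim_forest E X (forest_of_order E X xs)"
proof (induction xs arbitrary: X)
  case Nil
  then show ?case by (auto simp: elim_forest_def components_def)
next
  case (Cons x xs)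
  define p where "p = forest_of_order E (X - {x}) xs"
  define C where "C = component E X x"
  define q where "q = forest_of_order E X (x # xs)"
  have F: "elim_forest E (X - {x}) p" unfolding p_def using Cons by (intro Cons.IH) auto
  have q: "q v = (if v \<in> C - {x} \<and> p v = None then Some x else p v)" for v
    by (simp add: q_def p_def C_def Let_def)
  have C: "C \<in> components E X" "x \<in> C" using component_in[of x X] Cons.prems by (auto simp: C_def)
  have Cp: "C \<subseteq> X" "connected_on E C" "\<And>u v. u \<in> C \<Longrightarrow> v \<in> X - C \<Longrightarrow> {u, v} \<notin> E"
    using C(1) by (auto simp: components_iff)
  have agree: "elim_tree E D r q" if "elim_tree E D r p" for D r
    using elim_tree_cong[OF that, of q] elim_tree_parent[OF that] by (force simp: q)
  have "\<exists>r. elim_tree E D r q \<and> q r = None" if D: "D \<in> components E X" for D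
  proof (cases "D = C")
    case True
    have "elim_tree E C x q"
    proof (rule elim_tree.intros[OF Cp(2) C(2)], rule ballI)
      fix S assume S: "S \<in> components E (C - {x})"
      then have "S \<in> components E (X - {x})" using Cp unfolding components_iff by blast
      then obtain r where r: "elim_tree E S r p" "p r = None" using F by (auto simp: elim_forest_def)
      have "r \<in> C - {x}" using elim_tree_subset[OF r(1)] S by (auto simp: components_iff)
      then show "\<exists>r. elim_tree E S r q \<and> q r = Some x" using agree[OF r(1)] r(2) by (auto simp: q)
    qed
    moreover have "q x = None" using F by (auto simp: q elim_forest_def)
    ultimately show ?thesis using True by blast
  next
    case False
    then have disj: "D \<inter> C = {}" using components_eq[OF D C(1)] by blast
    then have "D \<in> components E (X - {x})" using D C(2) by (auto simp: components_iff)
    then obtain r where r: "elim_tree E D r p" "p r = None" using F by (auto simp: elim_forest_def)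
    have "q r = None" using r elim_tree_subset[OF r(1)] disj by (auto simp: q)
    then show ?thesis using agree[OF r(1)] by blast
  qed
  moreover have "q v = None" if "v \<notin> X" for v using that Cp F by (auto simp: q elim_forest_def)
  ultimately show ?case unfolding q_def[symmetric] by (auto simp: elim_forest_def)
qed

lemma initial_elim_forest: "elim_forest E {1..n} (initial_forest n E)"
  unfolding initial_forest_def by (rule elim_forest_of_order) auto

theorem algR_visits_elim_forest:
  "algR_visits n E Fs \<Longrightarrow> Fs \<noteq> [] \<and> hd Fs = initial_forest n E \<and> distinct Fs \<and>
     (\<forall>p\<in>set Fs. elim_forest E {1..n} p)"
proof (induction rule: algR_visits.induct)
  case init
  then show ?case using initial_elim_forest by simp
next
  case (step Fs q)
  then have "elim_forest E {1..n} (last Fs)" by simp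
  moreover obtain i j where "new_move E Fs i j q" using step by (auto simp: algR_step_def)
  ultimately have "elim_forest E {1..n} q" "q \<notin> set Fs"
    by (auto simp: new_move_def up_rotation_def down_rotation_def intro: rotate_elim_forest)
  then show ?case using step by auto
qed


section \<open>Algorithm R terminates and is deterministic\<close>

lemma algR_step_unique:
  assumes F: "elim_forest E V (last Fs)" and q: "algR_step E Fs q" "algR_step E Fs q'"
  shows "q = q'"
proof -
  obtain i j where 1: "\<forall>k>j. new_edges E Fs k = {}" "new_edges E Fs j = {i}" "new_move E Fs i j q"
    using q by (auto simp: algR_step_def)
  obtain i' j' where 2: "\<forall>k>j'. new_edges E Fs k = {}" "new_edges E Fs j' = {i'}"
      "new_move E Fs i' j' q'"
    using q by (auto simp: algR_step_def)
  have "j = j'" using 1 2 by (metis insert_not_empty linorder_neqE_nat)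
  then have "i = i'" using 1 2 by auto
  let ?p = "last Fs"
  have False if e: "?p i = Some j" "?p j = Some i"
  proof -
    have iV: "i \<in> V" using elim_forest_parent[OF F e(1)] by simp
    have star: "(i, w) \<in> {(a, b). ?p a = Some b}\<^sup>* \<Longrightarrow> w = i \<or> w = j" for w
      by (induction rule: rtrancl_induct) (use e in auto)
    let ?D = "component E V i"
    have D: "?D \<in> components E V" "i \<in> ?D" using component_in iV by auto
    then obtain s where s: "elim_tree E ?D s ?p" "?p s = None" using F by (auto simp: elim_forest_def)
    have "(i, s) \<in> {(a, b). ?p a = Some b}\<^sup>*"
      using elim_tree_subtree[OF s(1)] D by (auto simp: subtree_def)
    then show False using star[of s] s e by auto
  qed
  then show ?thesis using 1 2 \<open>i = i'\<close> \<open>j = j'\<close>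
    by (auto simp: new_move_def up_rotation_def down_rotation_def)
qed

lemma finite_elim_forests: "finite V \<Longrightarrow> finite {p. elim_forest E V p}"
proof (rule finite_subset)
  assume V: "finite V"
  show "{p. elim_forest E V p} \<subseteq> {p. dom p \<subseteq> V \<and> ran p \<subseteq> V}"
    using elim_forest_parent by (fastforce simp: ran_def)
  have "{p. dom p \<subseteq> V \<and> ran p \<subseteq> V} = (\<Union>A\<in>Pow V. {p. dom p = A \<and> ran p \<subseteq> V})" by auto
  then show "finite {p :: forest. dom p \<subseteq> V \<and> ran p \<subseteq> V}"
    using V by (auto intro!: finite_set_of_finite_maps intro: finite_subset)
qed

lemma algR_visits_by_length:
  "\<lbrakk>algR_visits n E Fs; algR_visits n E Gs; length Fs = length Gs\<rbrakk> \<Longrightarrow> Fs = Gs"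
proof (induction arbitrary: Gs rule: algR_visits.induct)
  case init
  from init(1) show ?case
  proof cases
    case (step Hs q)
    then show ?thesis using init algR_visits_elim_forest by fastforce
  qed simp
next
  case (step Fs q)
  from step.prems(1) show ?case
  proof cases
    case init
    then show ?thesis using step algR_visits_elim_forest by fastforce
  next
    case s: (step Hs q')
    then have "Fs = Hs" using step by auto
    moreover have "elim_forest E {1..n} (last Fs)"
      using algR_visits_elim_forest[OF step.hyps(1)] by simp
    ultimately show ?thesis using s step algR_step_unique by blast
  qed
qed

lemma algR_visits_shorter:
  "\<lbrakk>algR_visits n E Gs; algR_visits n E Fs; length Fs < length Gs\<rbrakk> \<Longrightarrow> \<exists>q. algR_step E Fs q"
proof (induction rule: algR_visits.induct)
  case init
  then show ?case using algR_visits_elim_forest by fastforce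
next
  case (step Gs q)
  show ?case
  proof (cases "length Fs = length Gs")
    case True
    then show ?thesis using algR_visits_by_length[OF step.prems(1) step.hyps(1)] step by blast
  next
    case False
    then show ?thesis using step by simp
  qed
qed

theorem algR_sequence_ex1: "\<exists>!Fs. algR_sequence n E Fs"
proof (rule ex_ex1I)
  let ?N = "card {p. elim_forest E {1..n} p}"
  have bound: "length Fs \<le> ?N" if "algR_visits n E Fs" for Fs
  proof -
    have "distinct Fs" "set Fs \<subseteq> {p. elim_forest E {1..n} p}"
      using algR_visits_elim_forest[OF that] by auto
    then show ?thesis
      using card_mono[OF finite_elim_forests[of "{1..n}" E], of "set Fs"]
      by (simp add: distinct_card)
  qed
  show "\<exists>Fs. algR_sequence n E Fs"
  proof (rule ccontr)
    assume a: "\<not> ?thesis"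
    have "\<exists>Fs. algR_visits n E Fs \<and> length Fs = Suc m" for m
    proof (induction m)
      case 0
      then show ?case using algR_visits.init[of n E] by fastforce
    next
      case (Suc m)
      then obtain Fs where "algR_visits n E Fs" "length Fs = Suc m" by blast
      moreover then obtain q where "algR_step E Fs q" using a by (auto simp: algR_sequence_def)
      ultimately show ?case using algR_visits.step[of n E Fs q] by (intro exI[of _ "Fs @ [q]"]) simp
    qed
    from this[of ?N] show False using bound by fastforce
  qed
  fix Fs Gs assume "algR_sequence n E Fs" "algR_sequence n E Gs"
  then show "Fs = Gs"
    using algR_visits_shorter algR_visits_by_length unfolding algR_sequence_def
    by (metis linorder_neqE_nat)
qed

end

theory Submission
  imports Defs
begin

text \<open>The last vertex \<open>n\<close> of a perfect elimination ordering is simplicial, so its neighbours lie on a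
  chain of every elimination forest \<open>p\<close> of \<open>G - n\<close>. The elimination forests of \<open>G\<close> that become \<open>p\<close>
  when \<open>n\<close> is deleted are obtained by inserting \<open>n\<close> somewhere on the path from below its deepest
  neighbour to above the root, and rotations of \<open>n\<close> move it along this path. Algorithm R therefore
  runs through the sequence of \<open>G - n\<close>, sweeping \<open>n\<close> alternately from the bottom to the top and
  back; its last forest arises from the last forest of \<open>G - n\<close> by putting \<open>n\<close> at the bottom if \<open>G - n\<close>
  has an even number of elimination forests, and at the top otherwise.

  If \<open>G\<close> is 2-connected, then swapping the root with its only child shows that the number of
  elimination forests of each prefix \<open>{1..k}\<close> with \<open>k \<ge> 2\<close> is even. Hence only the vertex 2 ends at
  the top, and the last forest arises from the first by rotating the edge \<open>{1, 2}\<close>. If \<open>G\<close> is a tree,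
  then the prefixes with 1, 2 and 3 vertices have 1, 2 and 5 elimination forests, so that 2 and 4 end
  up above 1, whereas a single rotation of the first forest puts only one vertex above its root 1.\<close>

section \<open>Elimination forests as parent maps\<close>

lemma subtree_refl [simp]: "v \<in> subtree p v"
  by (simp add: subtree_def)

lemma subtree_trans: "u \<in> subtree p v \<Longrightarrow> v \<in> subtree p w \<Longrightarrow> u \<in> subtree p w"
  by (simp add: subtree_def)

lemma subtree_mono: "v \<in> subtree p w \<Longrightarrow> subtree p v \<subseteq> subtree p w"
  using subtree_trans by blast

lemma subtree_parent: "p v = Some w \<Longrightarrow> v \<in> subtree p w"
  by (auto simp: subtree_def)

lemma subtree_step: "p v = Some w \<Longrightarrow> w \<in> subtree p u \<Longrightarrow> v \<in> subtree p u"
  using subtree_parent subtree_trans by blast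

lemma subtree_upE:
  assumes "v \<in> subtree p w" "v \<noteq> w"
  obtains y where "p v = Some y" "y \<in> subtree p w"
  using assms unfolding subtree_def by (auto elim: converse_rtranclE)

lemma subtree_childE:
  assumes "v \<in> subtree p w" "v \<noteq> w"
  obtains c where "p c = Some w" "v \<in> subtree p c"
  using assms unfolding subtree_def by (auto elim: rtranclE)

text \<open>A vertex has at most one parent, so its ancestors lie on a single upward path.\<close>

lemma subtree_linear:
  assumes "u \<in> subtree p a" "u \<in> subtree p b"
  shows "a \<in> subtree p b \<or> b \<in> subtree p a"
proof -
  let ?R = "{(a, b). p a = Some b}"
  have "(u, a) \<in> ?R\<^sup>*" "(u, b) \<in> ?R\<^sup>*" using assms by (auto simp: subtree_def)
  then have "(a, b) \<in> ?R\<^sup>* \<or> (b, a) \<in> ?R\<^sup>*"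
  proof (induction rule: converse_rtrancl_induct)
    case (step y z)
    then show ?case
      by (metis (mono_tags, lifting) case_prod_conv converse_rtranclE mem_Collect_eq option.inject
          r_into_rtrancl rtrancl_trans)
  qed simp
  then show ?thesis by (auto simp: subtree_def)
qed

text \<open>The first hypothesis prevents the loss of descendants, the second the gain of new ones.
  The parent of \<open>v\<close> itself is left free, since edges above \<open>v\<close> do not
  influence its subtree.\<close>

lemma subtree_cong:
  assumes "\<And>w. w \<in> subtree p v \<Longrightarrow> w \<noteq> v \<Longrightarrow> q w = p w"
    and "\<And>w y. q w = Some y \<Longrightarrow> y \<in> subtree p v \<Longrightarrow> w \<in> subtree p v"
  shows "subtree q v = subtree p v"
proof (rule set_eqI, rule iffI)
  fix u assume "u \<in> subtree q v"
  then have "(u, v) \<in> {(a, b). q a = Some b}\<^sup>*" by (simp add: subtree_def)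
  then show "u \<in> subtree p v"
    by (induction rule: converse_rtrancl_induct) (use assms(2) in auto)
next
  fix u assume "u \<in> subtree p v"
  then have "(u, v) \<in> {(a, b). p a = Some b}\<^sup>*" by (simp add: subtree_def)
  then show "u \<in> subtree q v"
  proof (induction rule: converse_rtrancl_induct)
    case (step y z)
    then have "y \<in> subtree p v" by (auto simp: subtree_def intro: converse_rtrancl_into_rtrancl)
    then show ?case using step assms(1)[of y] by (cases "y = v") (auto intro: subtree_step)
  qed simp
qed

definition acyc :: "forest \<Rightarrow> bool" where
  "acyc p \<longleftrightarrow> (\<forall>v w. p v = Some w \<longrightarrow> w \<notin> subtree p v)"

lemma acycD: "acyc p \<Longrightarrow> p v = Some w \<Longrightarrow> w \<notin> subtree p v"
  by (auto simp: acyc_def)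

lemma acyc_neq: "acyc p \<Longrightarrow> p v = Some w \<Longrightarrow> v \<noteq> w"
  using acycD by fastforce

lemma subtree_antisym:
  assumes "acyc p" "u \<in> subtree p v" "v \<in> subtree p u" shows "u = v"
proof (rule ccontr)
  assume "u \<noteq> v"
  then obtain y where "p u = Some y" "y \<in> subtree p v" using assms(2) by (meson subtree_upE)
  then show False using acycD[OF assms(1)] subtree_trans assms(3) by blast
qed

text \<open>If \<open>v\<close> had its parent below itself, every vertex below \<open>v\<close>
  would have a parent below \<open>v\<close>. Going up from \<open>v\<close> would then never reach
  a root.\<close>

lemma acycI:
  assumes "\<And>v. \<exists>r. v \<in> subtree p r \<and> p r = None"
  shows "acyc p"
  unfolding acyc_def
proof (intro allI impI notI)
  fix v w assume vw: "p v = Some w" "w \<in> subtree p v"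
  obtain r where r: "v \<in> subtree p r" "p r = None" using assms by blast
  have cyc: "\<exists>y. p u = Some y \<and> y \<in> subtree p v" if "u \<in> subtree p v" for u
    using that vw by (cases "u = v") (auto elim: subtree_upE)
  have "(v, r) \<in> {(a, b). p a = Some b}\<^sup>*" using r by (simp add: subtree_def)
  then have "r \<in> subtree p v"
    by (induction rule: rtrancl_induct) (use cyc in fastforce)+
  then show False using cyc r by fastforce
qed

section \<open>Elimination forests by local conditions\<close>

text \<open>A description without recursion on components, equivalent to \<open>elim_forest\<close>
  on finite vertex sets. Comparability of adjacent vertices keeps sibling subtrees apart; the last
  clause attaches each subtree to its parent and thereby makes all subtrees connected.\<close>

definition elim_map :: "nat set set \<Rightarrow> nat set \<Rightarrow> forest \<Rightarrow> bool" where
  "elim_map E V p \<longleftrightarrow> acyc p \<and> (\<forall>v w. p v = Some w \<longrightarrow> v \<in> V \<and> w \<in> V) \<and>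
     (\<forall>u\<in>V. \<forall>v\<in>V. {u, v} \<in> E \<longrightarrow> u \<in> subtree p v \<or> v \<in> subtree p u) \<and>
     (\<forall>v w. p v = Some w \<longrightarrow> (\<exists>u\<in>subtree p v. {u, w} \<in> E))"

lemma elim_tree_comparable:
  "elim_tree E C x p \<Longrightarrow> u \<in> C \<Longrightarrow> v \<in> C \<Longrightarrow> {u, v} \<in> E \<Longrightarrow> u \<in> subtree p v \<or> v \<in> subtree p u"
proof (induction rule: elim_tree.induct)
  case (1 C x p)
  have t: "elim_tree E C x p" using 1 by (intro elim_tree.intros) auto
  show ?case
  proof (cases "u = x \<or> v = x")
    case True
    then show ?thesis using elim_tree_subtree[OF t] 1 by blast
  next
    case False
    define D where "D = component E (C - {x}) u"
    have D: "D \<in> components E (C - {x})" "u \<in> D"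
      using component_in[of u "C - {x}"] False 1 by (auto simp: D_def)
    moreover have "v \<in> D" using D 1 False by (auto simp: components_iff)
    ultimately show ?thesis using 1(3) 1(6) by blast
  qed
qed

lemma elim_tree_parent_adjacent:
  "elim_tree E C x p \<Longrightarrow> v \<in> C \<Longrightarrow> v \<noteq> x \<Longrightarrow> p v = Some w \<Longrightarrow> \<exists>u\<in>subtree p v. {u, w} \<in> E"
proof (induction rule: elim_tree.induct)
  case (1 C x p)
  define D where "D = component E (C - {x}) v"
  have D: "D \<in> components E (C - {x})" "v \<in> D"
    using component_in[of v "C - {x}"] 1 by (auto simp: D_def)
  then obtain r where r: "elim_tree E D r p" "p r = Some x"
    "v \<noteq> r \<longrightarrow> (\<exists>u\<in>subtree p v. {u, w} \<in> E)" using 1(3) 1(6) by blast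
  show ?case
  proof (cases "v = r")
    case True
    then show ?thesis
      using components_adjacent[OF 1(1,2) D(1)] elim_tree_subtree[OF r(1)] r 1 by auto
  qed (use r in blast)
qed

lemma elim_forest_root:
  assumes "elim_forest E V p" "v \<in> V"
  shows "\<exists>r. elim_tree E (component E V v) r p \<and> p r = None \<and> v \<in> subtree p r"
proof -
  have D: "component E V v \<in> components E V" "v \<in> component E V v" using component_in assms by auto
  then obtain s where s: "elim_tree E (component E V v) s p" "p s = None"
    using assms by (auto simp: elim_forest_def)
  then show ?thesis using elim_tree_subtree[OF s(1)] D by blast
qed

lemma elim_forest_imp_elim_map:
  assumes F: "elim_forest E V p" shows "elim_map E V p"
  unfolding elim_map_def
proof (intro conjI allI ballI impI)
  show "acyc p"
  proof (rule acycI)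
    fix v show "\<exists>r. v \<in> subtree p r \<and> p r = None"
      using elim_forest_root[OF F, of v] F subtree_refl[of v p] unfolding elim_forest_def by blast
  qed
next
  fix v w assume "p v = Some w" then show "v \<in> V" "w \<in> V" using elim_forest_parent[OF F] by auto
next
  fix u v assume uv: "u \<in> V" "v \<in> V" "{u, v} \<in> E"
  obtain r where r: "elim_tree E (component E V u) r p" using elim_forest_root[OF F uv(1)] by blast
  have D: "component E V u \<in> components E V" "u \<in> component E V u" using component_in uv by auto
  then have "v \<in> component E V u" using uv by (auto simp: components_iff)
  then show "u \<in> subtree p v \<or> v \<in> subtree p u" using elim_tree_comparable[OF r] D uv by blast
next
  fix v w assume vw: "p v = Some w"
  then have v: "v \<in> V" using elim_forest_parent[OF F] by auto
  obtain r where r: "elim_tree E (component E V v) r p" "p r = None"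
    using elim_forest_root[OF F v] by blast
  have "v \<in> component E V v" using component_in v by auto
  then show "\<exists>u\<in>subtree p v. {u, w} \<in> E"
    using elim_tree_parent_adjacent[OF r(1), of v w] vw r by force
qed

lemma elim_mapD:
  assumes "elim_map E V p"
  shows "acyc p" "p v = Some w \<Longrightarrow> v \<in> V" "p v = Some w \<Longrightarrow> w \<in> V"
    "u \<in> V \<Longrightarrow> v \<in> V \<Longrightarrow> {u, v} \<in> E \<Longrightarrow> u \<in> subtree p v \<or> v \<in> subtree p u"
    "p v = Some w \<Longrightarrow> \<exists>u\<in>subtree p v. {u, w} \<in> E"
  using assms unfolding elim_map_def by auto

text \<open>A finite acyclic relation is well-founded in both directions. The first order gives
  induction from the leaves to the roots, the converse one induction from the roots
  downwards.\<close>

lemma wf_parent: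
  assumes "finite V" "elim_map E V p"
  shows "wf {(a, b). p a = Some b}" "wf ({(a, b). p a = Some b}\<inverse>)"
proof -
  let ?R = "{(a, b). p a = Some b}"
  have "?R \<subseteq> (\<lambda>v. (v, the (p v))) ` V" using elim_mapD(2)[OF assms(2)] by force
  then have "finite ?R" using assms(1) finite_surj by blast
  moreover have "acyclic ?R"
    unfolding acyclic_def
  proof (intro allI notI)
    fix v assume "(v, v) \<in> ?R\<^sup>+"
    then obtain w where "(v, w) \<in> ?R" "(w, v) \<in> ?R\<^sup>*" by (meson tranclD)
    then show False using acycD[OF elim_mapD(1)[OF assms(2)], of v w] by (simp add: subtree_def)
  qed
  ultimately show "wf ?R" "wf (?R\<inverse>)"
    by (simp_all add: finite_acyclic_wf finite_acyclic_wf_converse)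
qed

lemma elim_map_subtree_subset: "elim_map E V p \<Longrightarrow> x \<in> V \<Longrightarrow> subtree p x \<subseteq> V"
  using elim_mapD(2) by (metis subsetI subtree_upE)

text \<open>A common descendant would make the two siblings comparable; were they distinct, their
  common parent would lie below one of them.\<close>

lemma sibling_subtrees_disjoint:
  assumes "acyc p" "p c = Some w" "p d = Some w" "u \<in> subtree p c" "u \<in> subtree p d"
  shows "c = d"
proof -
  have "c = d" if "p c = Some w" "p d = Some w" "c \<in> subtree p d" for c d
    using that acycD[OF assms(1) that(2)] by (metis option.inject subtree_upE)
  then show ?thesis using subtree_linear[OF assms(4,5)] assms by metis
qed

text \<open>\<open>v\<close> lies below some child \<open>d\<close> of \<open>x\<close> and is
  comparable with \<open>u\<close>. If \<open>u\<close> is below \<open>v\<close>, then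
  \<open>u\<close> is below both \<open>c\<close> and \<open>d\<close>, which forces
  \<open>c = d\<close>. This is the closure property of a component once \<open>x\<close> is
  deleted.\<close>

lemma elim_map_child_closed:
  assumes M: "elim_map E V p" and c: "p c = Some x" and u: "u \<in> subtree p c"
    and v: "v \<in> subtree p x" "v \<noteq> x" and uv: "{u, v} \<in> E"
  shows "v \<in> subtree p c"
proof -
  have "c \<in> V" "x \<in> V" using elim_mapD[OF M] c by auto
  then have V: "u \<in> V" "v \<in> V" using elim_map_subtree_subset[OF M] u v by blast+
  obtain d where d: "p d = Some x" "v \<in> subtree p d" using v subtree_childE by metis
  have "u \<in> subtree p v \<or> v \<in> subtree p u" using elim_mapD(4)[OF M V uv] .
  then show ?thesis
  proof
    assume "u \<in> subtree p v"
    then have "u \<in> subtree p d" using d subtree_trans by blast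
    then show ?thesis using sibling_subtrees_disjoint[OF elim_mapD(1)[OF M] c d(1) u] d by blast
  qed (use u subtree_trans in blast)
qed

lemma connected_on_star:
  assumes "x \<in> C" "\<And>v. v \<in> C \<Longrightarrow> v \<noteq> x \<Longrightarrow> \<exists>D. connected_on E D \<and> D \<subseteq> C \<and> v \<in> D \<and> (\<exists>u\<in>D. {u, x} \<in> E)"
  shows "connected_on E C"
proof -
  have "(x, v) \<in> (edges_on E C)\<^sup>*" if vC: "v \<in> C" for v
  proof (cases "v = x")
    case False
    then obtain D u where D: "connected_on E D" "D \<subseteq> C" "v \<in> D" "u \<in> D" "{u, x} \<in> E"
      using assms(2)[OF vC] by blast
    have "edges_on E D \<subseteq> edges_on E C" using D by (auto simp: edges_on_def)
    then have "(u, v) \<in> (edges_on E C)\<^sup>*"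
      using D rtrancl_mono[of "edges_on E D" "edges_on E C"] unfolding connected_on_def by blast
    moreover have "(x, u) \<in> edges_on E C"
      using D assms(1) by (auto simp: edges_on_def insert_commute)
    ultimately show ?thesis by (rule converse_rtrancl_into_rtrancl[rotated])
  qed simp
  then show ?thesis unfolding connected_on_def using assms(1)
    by (metis edges_on_sym_star empty_iff rtrancl_trans)
qed

text \<open>Induction from the leaves: the subtrees of the children of \<open>x\<close> are exactly
  the components left after deleting \<open>x\<close>. They are connected by induction, closed by
  \<open>elim_map_child_closed\<close>, and each contains a neighbour of \<open>x\<close>, so the
  whole subtree is connected as well.\<close>

lemma elim_map_elim_tree:
  assumes "finite V" and M: "elim_map E V p"
  shows "elim_tree E (subtree p x) x p"
proof (induction x rule: wf_induct_rule[OF wf_parent(1)[OF assms]])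
  case (1 x)
  then have less: "elim_tree E (subtree p c) c p" if "p c = Some x" for c using that by simp
  have child: "subtree p c \<in> components E (subtree p x - {x})" if c: "p c = Some x" for c
  proof -
    have "subtree p c \<subseteq> subtree p x - {x}"
      using c subtree_parent subtree_trans acycD[OF elim_mapD(1)[OF M] c] by blast
    moreover have "connected_on E (subtree p c)" using less[OF c] elim_tree_subset by blast
    ultimately show ?thesis
      unfolding components_iff using elim_map_child_closed[OF M c] by blast
  qed
  have "connected_on E (subtree p x)"
  proof (rule connected_on_star[of x])
    fix v assume "v \<in> subtree p x" "v \<noteq> x"
    then obtain c where c: "p c = Some x" "v \<in> subtree p c" by (rule subtree_childE)
    have "connected_on E (subtree p c)" "subtree p c \<subseteq> subtree p x"
      using child[OF c(1)] by (auto simp: components_iff)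
    then show "\<exists>D. connected_on E D \<and> D \<subseteq> subtree p x \<and> v \<in> D \<and> (\<exists>u\<in>D. {u, x} \<in> E)"
      using c elim_mapD(5)[OF M c(1)] by blast
  qed simp
  then show ?case
  proof (rule elim_tree.intros, simp, intro ballI)
    fix D assume D: "D \<in> components E (subtree p x - {x})"
    then obtain s where s: "s \<in> D" "s \<in> subtree p x" "s \<noteq> x"
      by (auto simp: components_iff connected_on_def)
    then obtain c where c: "p c = Some x" "s \<in> subtree p c" by (meson subtree_childE)
    then have "D = subtree p c" using components_eq[OF D child] s by blast
    then show "\<exists>r. elim_tree E D r p \<and> p r = Some x" using less c by blast
  qed
qed

lemma elim_map_root:
  assumes "finite V" and M: "elim_map E V p"
  shows "\<exists>r. v \<in> subtree p r \<and> p r = None"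
proof (induction v rule: wf_induct_rule[OF wf_parent(2)[OF assms]])
  case (1 v)
  show ?case
  proof (cases "p v")
    case (Some w)
    then show ?thesis using 1[of w] subtree_step[of p v w] by auto
  qed (use subtree_refl in blast)
qed

lemma elim_map_root_closed:
  assumes M: "elim_map E V p" and r: "p r = None" "r \<in> V"
    and u: "u \<in> subtree p r" and v: "v \<in> V" and uv: "{u, v} \<in> E"
  shows "v \<in> subtree p r"
proof -
  have "u \<in> V" using elim_map_subtree_subset[OF M r(2)] u by blast
  then consider "u \<in> subtree p v" | "v \<in> subtree p u" using elim_mapD(4)[OF M _ v uv] by blast
  then show ?thesis
  proof cases
    case 1
    then have "r \<in> subtree p v \<or> v \<in> subtree p r" using subtree_linear u by blast
    then show ?thesis using r(1) by (metis option.distinct(1) subtree_refl subtree_upE)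
  qed (use u subtree_trans in blast)
qed

text \<open>For the converse direction, the subtree of a root is connected and no edge leaves it, so
  it is a component of the graph.\<close>

theorem elim_forest_iff_elim_map:
  assumes "finite V" shows "elim_forest E V p \<longleftrightarrow> elim_map E V p"
proof
  assume M: "elim_map E V p"
  have "\<exists>r. elim_tree E C r p \<and> p r = None" if C: "C \<in> components E V" for C
  proof -
    obtain s where s: "s \<in> C" "s \<in> V" using C by (auto simp: components_iff connected_on_def)
    obtain r where r: "s \<in> subtree p r" "p r = None" using elim_map_root[OF assms M] by blast
    have rV: "r \<in> V" using r s elim_mapD(3)[OF M] by (metis subtree_childE subtree_refl)
    have t: "elim_tree E (subtree p r) r p" by (rule elim_map_elim_tree[OF assms M])
    have "subtree p r \<in> components E V"
      unfolding components_iff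
      using elim_tree_subset[OF t] elim_map_root_closed[OF M r(2) rV] elim_map_subtree_subset[OF M rV]
      by blast
    then have "C = subtree p r" using components_eq[OF C] s r by blast
    then show ?thesis using t r by blast
  qed
  moreover have "p v = None" if "v \<notin> V" for v
    using elim_mapD(2)[OF M] that by (cases "p v") auto
  ultimately show "elim_forest E V p" by (auto simp: elim_forest_def)
qed (rule elim_forest_imp_elim_map)

lemma elim_map_connected_subtree:
  assumes "finite V" "elim_map E V p" shows "connected_on E (subtree p x)"
  using elim_map_elim_tree[OF assms] elim_tree_subset by blast

section \<open>Rotations of parent maps\<close>

text \<open>Inside the subtree of \<open>i\<close>, the only outside neighbours of the subtree of
  \<open>v\<close> can be \<open>i\<close> and \<open>j\<close>. With \<open>j\<close> deleted it
  therefore joins the component of \<open>i\<close> exactly when one of its vertices is adjacent to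
  \<open>i\<close>. This replaces components by adjacency in all later calculations with
  rotations.\<close>

lemma rotate_moves_iff:
  assumes fin: "finite V" and M: "elim_map E V p" and ji: "p j = Some i" and vj: "p v = Some j"
  shows "subtree p v \<subseteq> component E (subtree p i - {j}) i \<longleftrightarrow> (\<exists>u\<in>subtree p v. {u, i} \<in> E)"
proof -
  have ac: "acyc p" by (rule elim_mapD(1)[OF M])
  let ?K = "component E (subtree p i - {j}) i"
  have ij: "i \<noteq> j" using acyc_neq[OF ac ji] by simp
  have K: "?K \<in> components E (subtree p i - {j})" "i \<in> ?K"
    using component_in[of i "subtree p i - {j}" E] ij by auto
  have vj': "subtree p v \<subseteq> subtree p j" using subtree_mono[OF subtree_parent] vj by metis
  have ji': "subtree p j \<subseteq> subtree p i" using subtree_mono[OF subtree_parent] ji by metis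
  have iv: "i \<notin> subtree p v" "j \<notin> subtree p v"
    using acycD[OF ac vj] acycD[OF ac ji] vj' by auto
  have sub: "subtree p v \<subseteq> subtree p i - {j}"
    using iv vj' ji' by blast
  have con: "connected_on E (subtree p v)" by (rule elim_map_connected_subtree[OF fin M])
  show ?thesis
  proof
    assume "\<exists>u\<in>subtree p v. {u, i} \<in> E"
    then obtain u where u: "u \<in> subtree p v" "{u, i} \<in> E" by blast
    have "\<forall>w\<in>subtree p i - {j} - ?K. {i, w} \<notin> E" using K unfolding components_iff by blast
    then have "u \<in> ?K" using u sub by (auto simp: insert_commute)
    then show "subtree p v \<subseteq> ?K" using component_subset_components[OF con sub K(1)] u by blast
  next
    assume vK: "subtree p v \<subseteq> ?K"
    show "\<exists>u\<in>subtree p v. {u, i} \<in> E"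
    proof (rule ccontr)
      assume no: "\<not> ?thesis"
      have "\<forall>u\<in>subtree p v. \<forall>w\<in>(subtree p i - {j}) - subtree p v. {u, w} \<notin> E"
      proof (intro ballI notI)
        fix u w assume u: "u \<in> subtree p v" and w: "w \<in> (subtree p i - {j}) - subtree p v"
          and e: "{u, w} \<in> E"
        have wi: "w \<noteq> i" using no u e by blast
        have uj: "u \<in> subtree p j" using u vj' by blast
        have "w \<in> subtree p j"
          using elim_map_child_closed[OF M ji uj _ wi e] w by simp
        then show False using elim_map_child_closed[OF M vj u _ _ e] w by simp
      qed
      moreover have "connected_on E ?K" "?K \<subseteq> subtree p i - {j}" using K(1) by (auto simp: components_iff)
      moreover have "?K \<inter> subtree p v \<noteq> {}" using vK subtree_refl[of v p] by blast
      ultimately have "?K \<subseteq> subtree p v" using conn_sub by metis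
      then show False using K(2) iv by blast
    qed
  qed
qed

lemma rotate_edge_apply:
  assumes "finite V" "elim_map E V p" "p j = Some i"
  shows "rotate_edge E p i j v = (if v = j then p i else if v = i then Some j
     else if p v = Some j \<and> (\<exists>u\<in>subtree p v. {u, i} \<in> E) then Some i else p v)"
  using rotate_moves_iff[OF assms, of v] by (auto simp: rotate_edge_def)

lemma rotate_elim_map:
  "finite V \<Longrightarrow> elim_map E V p \<Longrightarrow> p j = Some i \<Longrightarrow> elim_map E V (rotate_edge E p i j)"
  using rotate_elim_forest elim_forest_iff_elim_map by blast

text \<open>If \<open>j\<close> is not below \<open>v\<close>, neither is its parent
  \<open>i\<close>, so no edge strictly below \<open>v\<close> is affected.\<close>

lemma subtree_rotate:
  assumes fin: "finite V" and M: "elim_map E V p" and ji: "p j = Some i"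
    and v: "j \<notin> subtree p v"
  shows "subtree (rotate_edge E p i j) v = subtree p v"
proof (rule subtree_cong)
  have i: "i \<notin> subtree p v" using v ji subtree_step by blast
  note q = rotate_edge_apply[OF fin M ji]
  fix w
  show "rotate_edge E p i j w = p w" if w: "w \<in> subtree p v" "w \<noteq> v"
  proof -
    obtain y where "p w = Some y" "y \<in> subtree p v" using w by (meson subtree_upE)
    then show ?thesis using w v i by (auto simp: q)
  qed
  show "w \<in> subtree p v" if "rotate_edge E p i j w = Some y" "y \<in> subtree p v" for y
  proof -
    have "p w = Some y" using that v i subtree_step[of p i y v] by (auto simp: q split: if_splits)
    then show ?thesis using that(2) subtree_step[of p w y v] by blast
  qed
qed

text \<open>A subtree that moved from \<open>j\<close> to \<open>i\<close> contains a neighbour of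
  its old parent \<open>j\<close> and therefore moves back. An old sibling of \<open>j\<close>
  contains no neighbour of \<open>j\<close>, because it lies in another component after deleting
  \<open>i\<close>, and therefore stays with \<open>i\<close>.\<close>

lemma rotate_rotate:
  assumes fin: "finite V" and M: "elim_map E V p" and ji: "p j = Some i"
  shows "rotate_edge E (rotate_edge E p i j) j i = p"
proof
  fix v
  let ?q = "rotate_edge E p i j"
  have ac: "acyc p" by (rule elim_mapD(1)[OF M])
  have ij: "i \<noteq> j" using acyc_neq[OF ac ji] by simp
  note q = rotate_edge_apply[OF fin M ji]
  have qi: "?q i = Some j" using ij by (simp add: q)
  note r = rotate_edge_apply[OF fin rotate_elim_map[OF fin M ji] qi]
  show "rotate_edge E ?q j i v = p v"
  proof (cases "v = i \<or> v = j")
    case True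
    then show ?thesis using ij ji by (auto simp: r q)
  next
    case False
    show ?thesis
    proof (cases "p v = Some j \<or> p v = Some i")
      case True
      have "j \<notin> subtree p v"
      proof
        assume j: "j \<in> subtree p v"
        show False
        proof (cases "p v = Some j")
          case True then show ?thesis using acycD[OF ac] j by blast
        next
          case n: False
          then have "p v = Some i" using True by simp
          moreover have "i \<in> subtree p v" using j False ji by (metis option.inject subtree_upE)
          ultimately show ?thesis using acycD[OF ac] by blast
        qed
      qed
      then have st: "subtree ?q v = subtree p v" by (rule subtree_rotate[OF fin M ji])
      show ?thesis
      proof (cases "p v = Some j")
        case True
        then show ?thesis using False ij elim_mapD(5)[OF M True] by (auto simp: r q st)
      next
        case n: False
        then have vi: "p v = Some i" using True by simp
        have "\<not> (\<exists>u\<in>subtree p v. {u, j} \<in> E)"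
          using elim_map_child_closed[OF M vi _ subtree_parent[of p j i, OF ji]] ij \<open>j \<notin> subtree p v\<close> by blast
        then show ?thesis using False n vi by (auto simp: r q st)
      qed
    next
      case n: False
      then show ?thesis using False by (auto simp: r q)
    qed
  qed
qed

section \<open>Insertion positions of a simplicial vertex\<close>

text \<open>After the rotation \<open>j\<close> is the root of an elimination tree on the vertex set
  formerly spanned by \<open>i\<close>. This measures the progress of a vertex that is rotated
  upwards.\<close>

lemma subtree_rotate_top:
  assumes fin: "finite V" and M: "elim_map E V p" and ji: "p j = Some i"
  shows "subtree p i \<subseteq> subtree (rotate_edge E p i j) j"
proof (rule elim_tree_subtree, rule rotate_root)
  show "elim_tree E (subtree p i) i p" by (rule elim_map_elim_tree[OF fin M])
  show "closed_tree p (subtree p i) i"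
    unfolding closed_tree_def using acycD[OF elim_mapD(1)[OF M]] subtree_step by blast
qed (rule ji)

section \<open>Deleting a simplicial vertex from a forest\<close>

text \<open>For a simplicial vertex this is the projection to the elimination forests of the graph
  without \<open>x\<close>, along which the run of Algorithm R decomposes. Children of a deleted
  root become roots.\<close>

definition del_vertex :: "nat \<Rightarrow> forest \<Rightarrow> forest" where
  "del_vertex x q = (\<lambda>v. if v = x then None else if q v = Some x then q x else q v)"

lemma subtree_del_vertex:
  assumes ac: "acyc q" and v: "v \<noteq> x"
  shows "subtree (del_vertex x q) v = subtree q v - {x}"
proof (rule set_eqI, rule iffI)
  let ?p = "del_vertex x q"
  fix u assume "u \<in> subtree ?p v"
  then have "(u, v) \<in> {(a, b). ?p a = Some b}\<^sup>*" by (simp add: subtree_def)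
  then show "u \<in> subtree q v - {x}"
  proof (induction rule: converse_rtrancl_induct)
    case (step y z)
    then have "y \<noteq> x" "q y = Some z \<or> q y = Some x \<and> q x = Some z"
      by (auto simp: del_vertex_def split: if_splits)
    then show ?case using step subtree_step[of q y] subtree_step[of q x] by blast
  qed (use v in simp)
next
  let ?p = "del_vertex x q"
  fix u assume u: "u \<in> subtree q v - {x}"
  then have "(u, v) \<in> {(a, b). q a = Some b}\<^sup>*" by (simp add: subtree_def)
  \<comment> \<open>When the path passes through \<open>x\<close>, its parent stands in for it: the
    children of \<open>x\<close> are attached there.\<close>
  then have "(u \<noteq> x \<longrightarrow> u \<in> subtree ?p v) \<and> (u = x \<longrightarrow> (\<exists>y. q x = Some y \<and> y \<in> subtree ?p v))"
  proof (induction rule: converse_rtrancl_induct)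
    case (step y z)
    then have yz: "q y = Some z" by simp
    show ?case
    proof (cases "z = x")
      case False
      then show ?thesis using step yz subtree_step[of ?p y z v] by (auto simp: del_vertex_def)
    next
      case True
      then have "y \<noteq> x" using acyc_neq[OF ac yz] by simp
      then show ?thesis using step yz True subtree_step[of ?p y] by (auto simp: del_vertex_def)
    qed
  qed (use v in simp)
  then show "u \<in> subtree ?p v" using u by simp
qed

text \<open>Applied later to a prefix of the ordering and its last vertex, whose neighbours in the
  prefix are all smaller and hence pairwise adjacent.\<close>

locale simplicial_vertex =
  fixes E :: "nat set set" and V :: "nat set" and x :: nat
  assumes fin: "finite V" and xV: "x \<in> V"
    and nbrs_adjacent: "\<lbrakk>u \<in> V; w \<in> V; u \<noteq> x; w \<noteq> x; u \<noteq> w; {u, x} \<in> E; {w, x} \<in> E\<rbrakk> \<Longrightarrow> {u, w} \<in> E"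
begin

abbreviation del where "del \<equiv> del_vertex x"

lemma child_nbr:
  assumes M: "elim_map E V q" and c: "q c = Some x"
  shows "\<exists>z\<in>subtree q c. z \<noteq> x \<and> z \<in> V \<and> {z, x} \<in> E"
proof -
  obtain z where z: "z \<in> subtree q c" "{z, x} \<in> E" using elim_mapD(5)[OF M c] by blast
  moreover have "z \<noteq> x" using z acycD[OF elim_mapD(1)[OF M] c] by blast
  moreover have "z \<in> V" using z elim_map_subtree_subset[OF M elim_mapD(2)[OF M c]] by blast
  ultimately show ?thesis by blast
qed

text \<open>Below every child of \<open>x\<close> there is a neighbour of \<open>x\<close>.
  Neighbours of \<open>x\<close> coincide or are adjacent, so they cannot be spread over two
  components.\<close>

lemma only_child:
  assumes M: "elim_map E V q" and c: "q c = Some x" and d: "q d = Some x"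
  shows "c = d"
proof -
  obtain u where u: "u \<in> subtree q c" "u \<noteq> x" "u \<in> V" "{u, x} \<in> E" using child_nbr[OF M c] by blast
  obtain w where w: "w \<in> subtree q d" "w \<noteq> x" "w \<in> V" "{w, x} \<in> E" using child_nbr[OF M d] by blast
  have "w \<in> subtree q c"
  proof (cases "u = w")
    case False
    then have "{u, w} \<in> E" using nbrs_adjacent u w by blast
    moreover have "w \<in> subtree q x" using w d subtree_trans subtree_parent by metis
    ultimately show ?thesis using elim_map_child_closed[OF M c u(1)] w by blast
  qed (use u in simp)
  then show ?thesis using sibling_subtrees_disjoint[OF elim_mapD(1)[OF M] c d] w by blast
qed

text \<open>If \<open>x\<close> has a child, a neighbour of \<open>x\<close> is found below that
  child. If \<open>x\<close> is a leaf, then \<open>x\<close> alone must provide the adjacency to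
  its parent, so the parent is a neighbour.\<close>

lemma nbr_below:
  assumes M: "elim_map E V q" and v: "x \<in> subtree q v" "v \<noteq> x"
  shows "\<exists>z\<in>subtree q v. z \<noteq> x \<and> z \<in> V \<and> {z, x} \<in> E"
proof -
  obtain y where y: "q x = Some y" "y \<in> subtree q v" using v by (metis subtree_upE)
  show ?thesis
  proof (cases "\<exists>c. q c = Some x")
    case True
    then obtain c where c: "q c = Some x" by blast
    have "subtree q c \<subseteq> subtree q v" using c v subtree_mono subtree_step by metis
    then show ?thesis using child_nbr[OF M c] by blast
  next
    case False
    obtain u where u: "u \<in> subtree q x" "{u, y} \<in> E" using elim_mapD(5)[OF M y(1)] by blast
    have "u = x" using u(1) False by (metis subtree_childE)
    then have "y \<noteq> x" "y \<in> V" "{y, x} \<in> E"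
      using u acyc_neq[OF elim_mapD(1)[OF M] y(1)] elim_mapD(3)[OF M y(1)] by (auto simp: insert_commute)
    then show ?thesis using y by blast
  qed
qed

text \<open>An edge from \<open>x\<close> to \<open>i\<close> can be replaced by one from another
  neighbour \<open>z\<close> of \<open>x\<close> in \<open>S\<close>: both \<open>z\<close> and
  \<open>i\<close> are neighbours of \<open>x\<close>, and they differ because \<open>i\<close> is
  outside \<open>S\<close>.\<close>

lemma adjacent_without:
  assumes "\<exists>z\<in>S. z \<noteq> x \<and> z \<in> V \<and> {z, x} \<in> E" "i \<notin> S" "i \<in> V" "i \<noteq> x"
  shows "(\<exists>u\<in>S. {u, i} \<in> E) \<longleftrightarrow> (\<exists>u\<in>S - {x}. {u, i} \<in> E)"
proof
  assume "\<exists>u\<in>S. {u, i} \<in> E"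
  then obtain u where u: "u \<in> S" "{u, i} \<in> E" by blast
  show "\<exists>u\<in>S - {x}. {u, i} \<in> E"
  proof (cases "u = x")
    case True
    obtain z where z: "z \<in> S" "z \<noteq> x" "z \<in> V" "{z, x} \<in> E" using assms by blast
    then have "{z, i} \<in> E" using nbrs_adjacent[of z i] assms u True by (auto simp: insert_commute)
    then show ?thesis using z by blast
  qed (use u in blast)
qed blast

lemma adjacent_del:
  assumes M: "elim_map E V q" and v: "v \<noteq> x" and i: "i \<notin> subtree q v" "i \<in> V" "i \<noteq> x"
  shows "(\<exists>u\<in>subtree q v. {u, i} \<in> E) \<longleftrightarrow> (\<exists>u\<in>subtree (del q) v. {u, i} \<in> E)"
proof (cases "x \<in> subtree q v")
  case True
  then show ?thesis
    using adjacent_without[OF nbr_below[OF M True v] i] subtree_del_vertex[OF elim_mapD(1)[OF M] v]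
    by simp
next
  case False
  then show ?thesis using subtree_del_vertex[OF elim_mapD(1)[OF M] v] by simp
qed

lemma subtree_only_child:
  assumes M: "elim_map E V q" and c: "q c = Some x"
  shows "subtree q x = insert x (subtree q c)"
proof
  show "subtree q x \<subseteq> insert x (subtree q c)" using only_child[OF M c] by (metis insert_iff subsetI subtree_childE)
  show "insert x (subtree q c) \<subseteq> subtree q x" using c subtree_mono subtree_parent by (metis insert_subset subtree_refl)
qed

lemma adjacent_child:
  assumes M: "elim_map E V q" and c: "q c = Some x" and i: "i \<notin> subtree q x" "i \<in> V"
  shows "(\<exists>u\<in>subtree q x. {u, i} \<in> E) \<longleftrightarrow> (\<exists>u\<in>subtree (del q) c. {u, i} \<in> E)"
proof -
  have ac: "acyc q" by (rule elim_mapD(1)[OF M])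
  have "\<exists>z\<in>subtree q x. z \<noteq> x \<and> z \<in> V \<and> {z, x} \<in> E"
    using child_nbr[OF M c] subtree_only_child[OF M c] by blast
  moreover have "i \<noteq> x" using i by auto
  moreover have "subtree q x - {x} = subtree (del q) c"
    using subtree_del_vertex[OF ac acyc_neq[OF ac c]] subtree_only_child[OF M c] by blast
  ultimately show ?thesis using adjacent_without[of "subtree q x" i] i by simp
qed

text \<open>The point is the adjacency to the new parents: by \<open>adjacent_without\<close>,
  removing \<open>x\<close> from a subtree does not change which vertices outside are adjacent to
  it.\<close>

lemma del_elim_map:
  assumes M: "elim_map E V q" shows "elim_map E (V - {x}) (del q)"
proof -
  have ac: "acyc q" by (rule elim_mapD(1)[OF M])
  note st = subtree_del_vertex[OF ac, of _ x]
  have step: "v \<noteq> x \<and> w \<noteq> x \<and> (q v = Some w \<or> q v = Some x \<and> q x = Some w)"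
    if "del q v = Some w" for v w
    using that acyc_neq[OF ac] by (auto simp: del_vertex_def split: if_splits)
  have nin: "w \<notin> subtree q v" if "del q v = Some w" for v w
    using step[OF that] acycD[OF ac] subtree_step by metis
  show ?thesis
    unfolding elim_map_def
  proof (intro conjI allI ballI impI)
    show "acyc (del q)" unfolding acyc_def using nin step st by (metis DiffD1)
    fix v w assume vw: "del q v = Some w"
    show "v \<in> V - {x}" "w \<in> V - {x}" using step[OF vw] elim_mapD(2,3)[OF M] by auto
    have "\<exists>u\<in>subtree q v. {u, w} \<in> E" if "q v = Some w" using elim_mapD(5)[OF M that] .
    then show "\<exists>u\<in>subtree (del q) v. {u, w} \<in> E"
      using step[OF vw] nin[OF vw] adjacent_del[OF M, of v w] adjacent_child[OF M, of v w]
        elim_mapD(3,5)[OF M] acycD[OF ac] by metis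
  next
    fix u v assume "u \<in> V - {x}" "v \<in> V - {x}" "{u, v} \<in> E"
    then show "u \<in> subtree (del q) v \<or> v \<in> subtree (del q) u"
      using elim_mapD(4)[OF M, of u v] st[of u] st[of v] by blast
  qed
qed

text \<open>Which subtrees move depends only on their adjacency to \<open>i\<close>, and deleting
  \<open>x\<close> leaves this unchanged.\<close>

lemma del_rotate:
  assumes M: "elim_map E V q" and ji: "q j = Some i" and ix: "i \<noteq> x" and jx: "j \<noteq> x"
  shows "del (rotate_edge E q i j) = rotate_edge E (del q) i j"
proof
  fix v
  have ac: "acyc q" by (rule elim_mapD(1)[OF M])
  have iV: "i \<in> V" by (rule elim_mapD(3)[OF M ji])
  have ij: "i \<noteq> j" using acyc_neq[OF ac ji] by simp
  have pji: "del q j = Some i" using ji ix jx by (simp add: del_vertex_def)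
  note r = rotate_edge_apply[OF fin M ji]
  note s = rotate_edge_apply[OF finite_Diff[OF fin] del_elim_map[OF M] pji]
  have iv: "i \<notin> subtree q v" if "q v = Some j" for v
    using that ji acycD[OF ac] subtree_step by metis
  consider "v = x" | "v = j" | "v = i" | "v \<noteq> x" "v \<noteq> j" "v \<noteq> i" "q v = Some j"
    | "v \<noteq> x" "v \<noteq> j" "v \<noteq> i" "q v = Some x"
    | "v \<noteq> x" "v \<noteq> j" "v \<noteq> i" "q v \<noteq> Some j" "q v \<noteq> Some x" by blast
  then show "del (rotate_edge E q i j) v = rotate_edge E (del q) i j v"
  proof cases
    case 1
    then show ?thesis using ix jx unfolding s by (simp add: del_vertex_def)
  next
    case 2
    have "\<not> (q i = Some x \<and> q x = Some j)"
      using ji acycD[OF ac, of j i] subtree_step[of q i x j] subtree_parent[of q x j] by auto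
    then show ?thesis using 2 ix jx ij unfolding s unfolding del_vertex_def r by auto
  next
    case 3
    then show ?thesis using ix jx ij unfolding s unfolding del_vertex_def r by auto
  next
    case 4
    then show ?thesis using adjacent_del[OF M 4(1) iv[OF 4(4)] iV ix] ix jx
      unfolding s unfolding del_vertex_def r by auto
  next
    case 5
    show ?thesis
    \<comment> \<open>If \<open>x\<close> is a child of \<open>j\<close>, then \<open>v\<close>
      takes its place below \<open>j\<close> after the deletion. The subtrees of \<open>x\<close>
      and \<open>v\<close> both contain a neighbour of \<open>i\<close> or both contain none, so
      \<open>v\<close> moves exactly when \<open>x\<close> does.\<close>
    proof (cases "q x = Some j")
      case True
      then show ?thesis using 5 adjacent_child[OF M 5(4) iv[OF True] iV] ix jx
        unfolding s unfolding del_vertex_def r by auto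
    next
      case False
      then show ?thesis using 5 ix jx unfolding s unfolding del_vertex_def r by auto
    qed
  next
    case 6
    then show ?thesis using ix jx unfolding s unfolding del_vertex_def r by auto
  qed
qed

text \<open>A child of \<open>x\<close> has a neighbour of \<open>y\<close> below it, so it always
  moves to \<open>y\<close>. The rotation thus only swaps \<open>x\<close> with its parent on their
  path.\<close>

lemma del_rotate_up:
  assumes M: "elim_map E V q" and y: "q x = Some y"
  shows "del (rotate_edge E q y x) = del q"
proof
  fix v
  have ac: "acyc q" by (rule elim_mapD(1)[OF M])
  note r = rotate_edge_apply[OF fin M y]
  have yx: "y \<noteq> x" using acyc_neq[OF ac y] by simp
  have "q y \<noteq> Some x" using acycD[OF ac y] subtree_parent by metis
  moreover have "\<exists>u\<in>subtree q v. {u, y} \<in> E" if "q v = Some x"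
  proof -
    have "\<exists>u\<in>subtree (del q) v. {u, y} \<in> E"
      using adjacent_child[OF M that acycD[OF ac y] elim_mapD(3)[OF M y]] elim_mapD(5)[OF M y] by blast
    then show ?thesis using subtree_del_vertex[OF ac acyc_neq[OF ac that]] by blast
  qed
  ultimately show "del (rotate_edge E q y x) v = del q v"
    using yx y by (auto simp: del_vertex_def r)
qed

lemma del_rotate_down:
  assumes M: "elim_map E V q" and c: "q c = Some x"
  shows "del (rotate_edge E q x c) = del q"
proof -
  let ?r = "rotate_edge E q x c"
  have "?r x = Some c" using acyc_neq[OF elim_mapD(1)[OF M] c] by (simp add: rotate_edge_def)
  then have "del (rotate_edge E ?r c x) = del ?r"
    by (rule del_rotate_up[OF rotate_elim_map[OF fin M c]])
  then show ?thesis using rotate_rotate[OF fin M c] by simp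
qed

section \<open>The fiber of the deletion map and its lowest position\<close>

definition fiber :: "forest \<Rightarrow> forest set" where
  "fiber p = {q. elim_map E V q \<and> del q = p}"

definition at_bottom :: "forest \<Rightarrow> bool" where
  "at_bottom q \<longleftrightarrow> (\<forall>v. q v \<noteq> Some x)"

lemma at_bottom_subtree: "at_bottom q \<Longrightarrow> subtree q x = {x}"
  unfolding at_bottom_def by (metis insertI1 subsetI subset_singletonD empty_iff subtree_childE subtree_refl singletonD)

text \<open>A leaf is adjacent to its parent \<open>d\<close>. In \<open>r\<close>, where
  \<open>x\<close> is a leaf too, \<open>d\<close> must be above \<open>x\<close> and hence above or
  equal to the parent of \<open>x\<close>. By symmetry the two parents agree.\<close>

lemma bottom_parent_below:
  assumes q: "q \<in> fiber p" "at_bottom q" and r: "r \<in> fiber p" "at_bottom r" and d: "q x = Some d"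
  shows "\<exists>e. r x = Some e \<and> e \<in> subtree p d"
proof -
  have M: "elim_map E V q" and N: "elim_map E V r" and p: "del r = p" using q r by (auto simp: fiber_def)
  have dV: "d \<in> V" "d \<noteq> x" using elim_mapD(3)[OF M d] acyc_neq[OF elim_mapD(1)[OF M] d] by auto
  have "{x, d} \<in> E" using elim_mapD(5)[OF M d] at_bottom_subtree[OF q(2)] by auto
  then have "x \<in> subtree r d"
    using elim_mapD(4)[OF N xV dV(1)] at_bottom_subtree[OF r(2)] dV by blast
  then obtain e where e: "r x = Some e" "e \<in> subtree r d" using dV by (metis subtree_upE)
  have "e \<noteq> x" using acyc_neq[OF elim_mapD(1)[OF N] e(1)] by simp
  then show ?thesis using e p subtree_del_vertex[OF elim_mapD(1)[OF N] dV(2)] by blast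
qed

lemma bottom_unique:
  assumes q: "q \<in> fiber p" "at_bottom q" and r: "r \<in> fiber p" "at_bottom r"
  shows "q = r"
proof
  fix v
  show "q v = r v"
  proof (cases "v = x")
    case False
    have "q v = del q v" "r v = del r v" using False q r by (auto simp: at_bottom_def del_vertex_def)
    then show ?thesis using q r by (simp add: fiber_def)
  next
    case True
    have ac: "acyc p" using q del_elim_map elim_mapD(1) by (auto simp: fiber_def)
    show ?thesis
      using bottom_parent_below[OF q r] bottom_parent_below[OF r q] subtree_antisym[OF ac] True
      by (cases "q x"; cases "r x") fastforce+
  qed
qed

text \<open>\<open>x\<close> is hung below its deepest neighbour, or stands alone as a root if it
  has no neighbours.\<close>

lemma bottom_exists:
  assumes P: "elim_map E (V - {x}) p" shows "\<exists>q\<in>fiber p. at_bottom q"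
proof -
  have ac: "acyc p" by (rule elim_mapD(1)[OF P])
  have px: "p x = None" "\<And>v. p v \<noteq> Some x" using elim_mapD(2,3)[OF P] by fastforce+
  define N where "N = {u \<in> V - {x}. {u, x} \<in> E}"
  show ?thesis
  proof (cases "N = {}")
    case True
    have "elim_map E V p"
      unfolding elim_map_def
    proof (intro conjI allI ballI impI)
      fix u v assume uv: "u \<in> V" "v \<in> V" "{u, v} \<in> E"
      show "u \<in> subtree p v \<or> v \<in> subtree p u"
      proof (cases "u = x \<or> v = x")
        case True
        then have "u = v" using uv \<open>N = {}\<close> by (auto simp: N_def insert_commute)
        then show ?thesis by simp
      qed (use uv elim_mapD(4)[OF P] in blast)
    qed (use elim_mapD[OF P] in blast)+
    moreover have "del p = p" using px by (auto simp: del_vertex_def)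
    ultimately show ?thesis using px by (auto simp: fiber_def at_bottom_def)
  next
    case False
    have "wf ({(a, b). p a = Some b}\<^sup>+)" using wf_parent(1)[OF finite_Diff[OF fin] P] by (rule wf_trancl)
    then obtain d where d: "d \<in> N" "\<And>u. (u, d) \<in> {(a, b). p a = Some b}\<^sup>+ \<Longrightarrow> u \<notin> N"
      using False by (metis wfE_min all_not_in_conv)
    \<comment> \<open>The neighbours are pairwise adjacent, hence comparable, and by minimality none
      lies strictly below \<open>d\<close>.\<close>
    have deep: "d \<in> subtree p u" if u: "u \<in> N" for u
    proof (rule ccontr)
      assume a: "d \<notin> subtree p u"
      then have "u \<noteq> d" by auto
      then have "{u, d} \<in> E" using nbrs_adjacent u d(1) by (auto simp: N_def)
      then have "u \<in> subtree p d" using elim_mapD(4)[OF P] u d(1) a by (auto simp: N_def)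
      then have "(u, d) \<in> {(a, b). p a = Some b}\<^sup>+"
        using \<open>u \<noteq> d\<close> by (simp add: subtree_def rtrancl_eq_or_trancl)
      then show False using d(2) u by blast
    qed
    have dx: "d \<noteq> x" "d \<in> V" "{x, d} \<in> E" using d(1) by (auto simp: N_def insert_commute)
    define q where "q = p(x := Some d)"
    have qv: "q v = (if v = x then Some d else p v)" for v by (simp add: q_def)
    have bot: "at_bottom q" using px dx by (simp add: at_bottom_def qv)
    have up: "subtree p v \<subseteq> subtree q v" for v
    proof -
      have "{(a, b). p a = Some b} \<subseteq> {(a, b). q a = Some b}" using px by (auto simp: qv)
      then show ?thesis unfolding subtree_def using rtrancl_mono by blast
    qed
    have delq: "del q = p" using px dx by (auto simp: del_vertex_def qv)
    have down: "u \<in> subtree p v" if "u \<in> subtree q v" "u \<noteq> x" for u v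
    proof -
      have "(u, v) \<in> {(a, b). q a = Some b}\<^sup>*" using that by (simp add: subtree_def)
      then have "u \<noteq> x \<longrightarrow> u \<in> subtree p v"
      proof (induction rule: converse_rtrancl_induct)
        case (step y z)
        then show ?case using px subtree_step[of p y z v] by (auto simp: qv split: if_splits)
      qed simp
      then show ?thesis using that by simp
    qed
    have "elim_map E V q"
      unfolding elim_map_def
    proof (intro conjI allI ballI impI)
      show "acyc q"
        unfolding acyc_def
      proof (intro allI impI notI)
        fix v w assume vw: "q v = Some w" "w \<in> subtree q v"
        have wx: "w \<noteq> x" using vw bot by (auto simp: at_bottom_def)
        show False
        proof (cases "v = x")
          case True
          then show ?thesis using vw wx at_bottom_subtree[OF bot] by simp
        next
          case False
          then show ?thesis using vw down[OF vw(2) wx] acycD[OF ac] by (simp add: qv)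
        qed
      qed
      fix v w assume vw: "q v = Some w"
      show "v \<in> V" "w \<in> V" using vw dx xV elim_mapD(2,3)[OF P] by (auto simp: qv split: if_splits)
      show "\<exists>u\<in>subtree q v. {u, w} \<in> E"
        using vw dx elim_mapD(5)[OF P, of v w] up[of v] subtree_refl[of x q]
        by (auto simp: qv split: if_splits)
    next
      fix u v assume uv: "u \<in> V" "v \<in> V" "{u, v} \<in> E"
      have nb: "x \<in> subtree q u" if "u \<in> N" for u
        using subtree_step[of q x d u] deep[OF that] up[of u] by (auto simp: qv)
      show "u \<in> subtree q v \<or> v \<in> subtree q u"
      proof (cases "u = x \<or> v = x")
        case True
        moreover have "w \<in> N" if "w \<in> V" "w \<noteq> x" "{w, x} \<in> E" for w using that by (simp add: N_def)
        ultimately consider "u = v" | "u = x" "v \<in> N" | "v = x" "u \<in> N"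
          using uv by (metis insert_commute)
        then show ?thesis using nb by cases auto
      next
        case False
        then show ?thesis using elim_mapD(4)[OF P, of u v] uv up by blast
      qed
    qed
    then show ?thesis using bot delq by (auto simp: fiber_def)
  qed
qed

definition bottom :: "forest \<Rightarrow> forest" where
  "bottom p = (THE q. q \<in> fiber p \<and> at_bottom q)"

lemma bottom:
  assumes "elim_map E (V - {x}) p" shows "bottom p \<in> fiber p" "at_bottom (bottom p)"
proof -
  have "\<exists>!q. q \<in> fiber p \<and> at_bottom q" using bottom_exists[OF assms] bottom_unique by blast
  then have "bottom p \<in> fiber p \<and> at_bottom (bottom p)" unfolding bottom_def by (rule theI')
  then show "bottom p \<in> fiber p" "at_bottom (bottom p)" by auto
qed

lemma bottom_eqI: "q \<in> fiber p \<Longrightarrow> at_bottom q \<Longrightarrow> bottom p = q"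
  unfolding bottom_def using bottom_unique by blast

section \<open>Raising the vertex through its fiber\<close>

text \<open>A forest with \<open>x\<close> as a root is a fixed point, so that positions beyond the
  top all equal the top.\<close>

definition up :: "forest \<Rightarrow> forest" where
  "up q = (case q x of None \<Rightarrow> q | Some y \<Rightarrow> rotate_edge E q y x)"

lemma up_fiber: "q \<in> fiber p \<Longrightarrow> up q \<in> fiber p"
  by (auto simp: up_def fiber_def rotate_elim_map[OF fin] del_rotate_up split: option.split)

lemma up_parent: "q x = Some y \<Longrightarrow> up q x = q y"
  by (simp add: up_def rotate_edge_def)

\<comment> \<open>the forest that arises from \<open>p\<close> by inserting \<open>x\<close> at the \<open>t\<close>-th position from the bottom\<close>
definition pos :: "forest \<Rightarrow> nat \<Rightarrow> forest" where
  "pos p t = (up ^^ t) (bottom p)"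

definition top_pos :: "forest \<Rightarrow> nat" where
  "top_pos p = (LEAST t. pos p t x = None)"

lemma pos_simps [simp]: "pos p 0 = bottom p" "pos p (Suc t) = up (pos p t)"
  by (simp_all add: pos_def)

context
  fixes p assumes P: "elim_map E (V - {x}) p"
begin

lemma pos_fiber: "pos p t \<in> fiber p"
  by (induction t) (auto simp: bottom(1)[OF P] up_fiber)

lemma pos_elim_map: "elim_map E V (pos p t)"
  using pos_fiber by (auto simp: fiber_def)

text \<open>Each rotation of a non-root \<open>x\<close> upwards strictly enlarges the subtree of
  \<open>x\<close>, whose size is bounded by that of \<open>V\<close>.\<close>

lemma ex_top: "\<exists>t. pos p t x = None"
proof (rule ccontr)
  assume a: "\<not> ?thesis"
  have "t \<le> card (subtree (pos p t) x)" for t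
  proof (induction t)
    case (Suc t)
    let ?q = "pos p t"
    obtain y where y: "?q x = Some y" using a by (metis not_None_eq)
    have r: "pos p (Suc t) = rotate_edge E ?q y x" using y by (simp add: up_def)
    have "subtree ?q x \<subseteq> subtree ?q y" "y \<notin> subtree ?q x"
      using y subtree_mono subtree_parent acycD[OF elim_mapD(1)[OF pos_elim_map]] by metis+
    then have "subtree ?q x \<subset> subtree ?q y" by auto
    also have "\<dots> \<subseteq> subtree (pos p (Suc t)) x"
      unfolding r by (rule subtree_rotate_top[OF fin pos_elim_map y])
    finally have "card (subtree ?q x) < card (subtree (pos p (Suc t)) x)"
      using psubset_card_mono finite_subset[OF elim_map_subtree_subset[OF pos_elim_map xV] fin] by blast
    then show ?case using Suc by simp
  qed simp
  from this[of "Suc (card V)"] show False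
    using card_mono[OF fin elim_map_subtree_subset[OF pos_elim_map xV, of "Suc (card V)"]] by simp
qed

lemma top_pos: "pos p (top_pos p) x = None"
  unfolding top_pos_def using ex_top by (rule LeastI_ex)

lemma below_top: "t < top_pos p \<Longrightarrow> \<exists>y. pos p t x = Some y"
  unfolding top_pos_def using not_less_Least by blast

lemma pos_step_up: "t < top_pos p \<Longrightarrow> pos p t x = Some y \<Longrightarrow> rotate_edge E (pos p t) y x = pos p (Suc t)"
  by (simp add: up_def)

text \<open>At a positive position the only child of \<open>x\<close> is the vertex that
  \<open>x\<close> has just passed, and rotating it up undoes that step.\<close>

lemma pos_step_down:
  assumes t: "t \<le> top_pos p" and c: "pos p t c = Some x"
  shows "\<exists>s. t = Suc s \<and> rotate_edge E (pos p t) x c = pos p s"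
proof (cases t)
  case 0
  then show ?thesis using c bottom(2)[OF P] by (simp add: at_bottom_def)
next
  case (Suc s)
  obtain y where y: "pos p s x = Some y" using below_top[of s] t Suc by auto
  have r: "pos p t = rotate_edge E (pos p s) y x" using y Suc by (simp add: up_def)
  have "x \<noteq> y" using acyc_neq[OF elim_mapD(1)[OF pos_elim_map] y] by simp
  then have "pos p t y = Some x" unfolding r by (simp add: rotate_edge_def)
  then have "c = y" using only_child[OF pos_elim_map c] by blast
  then show ?thesis using rotate_rotate[OF fin pos_elim_map y] r Suc by simp
qed

lemma pos_has_child: "t < top_pos p \<Longrightarrow> \<exists>c. pos p (Suc t) c = Some x"
proof -
  assume t: "t < top_pos p"
  obtain y where y: "pos p t x = Some y" using below_top[OF t] by blast
  have "x \<noteq> y" using acyc_neq[OF elim_mapD(1)[OF pos_elim_map] y] by simp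
  then show ?thesis using y by (auto simp: up_def rotate_edge_def)
qed

text \<open>Two equal positions could both be lowered by the same rotation, until one reaches the
  bottom, where \<open>x\<close> has no child, while the other has not.\<close>

lemma pos_neq: "s < t \<Longrightarrow> t \<le> top_pos p \<Longrightarrow> pos p s \<noteq> pos p t"
proof (induction s arbitrary: t)
  case 0
  then obtain u where u: "t = Suc u" by (cases t) auto
  then have "\<exists>c. pos p t c = Some x" using pos_has_child[of u] 0 by simp
  then show ?case using bottom(2)[OF P] by (auto simp: at_bottom_def)
next
  case (Suc s)
  then obtain u where u: "t = Suc u" by (cases t) auto
  show ?case
  proof
    assume eq: "pos p (Suc s) = pos p t"
    obtain c where c: "pos p t c = Some x" using pos_has_child[of u] Suc u by auto
    have "rotate_edge E (pos p t) x c = pos p s"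
      using pos_step_down[of "Suc s" c] c eq Suc by (metis nat.inject less_imp_le order.trans)
    moreover have "rotate_edge E (pos p t) x c = pos p u"
      using pos_step_down[of t c] c Suc u by auto
    ultimately show False using Suc.IH[of u] Suc.prems u by simp
  qed
qed

lemma pos_beyond: "top_pos p \<le> t \<Longrightarrow> pos p t = pos p (top_pos p)"
proof (induction t rule: dec_induct)
  case (step t)
  then show ?case using top_pos by (simp add: up_def)
qed simp

text \<open>Unless \<open>x\<close> is a leaf, rotating its child up lowers \<open>x\<close> within
  the fiber and shrinks its subtree. Induction gives a position for the lowered forest, and
  \<open>q\<close> is the next one.\<close>

lemma fiber_pos:
  assumes "q \<in> fiber p" shows "\<exists>t. q = pos p t"
  using assms
proof (induction "card (subtree q x)" arbitrary: q rule: less_induct)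
  case less
  have M: "elim_map E V q" using less by (simp add: fiber_def)
  show ?case
  proof (cases "at_bottom q")
    case True
    then show ?thesis using bottom_eqI[OF less(2)] pos_simps(1) by metis
  next
    case False
    then obtain c where c: "q c = Some x" by (auto simp: at_bottom_def)
    define r where "r = rotate_edge E q x c"
    have N: "elim_map E V r" unfolding r_def by (rule rotate_elim_map[OF fin M c])
    have "x \<noteq> c" using acyc_neq[OF elim_mapD(1)[OF M] c] by simp
    then have rx: "r x = Some c" by (simp add: r_def rotate_edge_def)
    have q: "rotate_edge E r c x = q" unfolding r_def by (rule rotate_rotate[OF fin M c])
    have "subtree r x \<subseteq> subtree r c" "c \<notin> subtree r x"
      using rx subtree_mono subtree_parent acycD[OF elim_mapD(1)[OF N]] by metis+
    then have "subtree r x \<subset> subtree r c" by auto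
    also have "\<dots> \<subseteq> subtree q x" using subtree_rotate_top[OF fin N rx] q by simp
    finally have "card (subtree r x) < card (subtree q x)"
      using psubset_card_mono finite_subset[OF elim_map_subtree_subset[OF M xV] fin] by blast
    moreover have "r \<in> fiber p" using N less(2) del_rotate_down[OF M c] by (simp add: fiber_def r_def)
    ultimately obtain t where "r = pos p t" using less(1) by blast
    then have "q = pos p (Suc t)" using q rx by (simp add: up_def)
    then show ?thesis by blast
  qed
qed

lemma fiber_eq: "fiber p = pos p ` {..top_pos p}"
proof
  show "fiber p \<subseteq> pos p ` {..top_pos p}"
  proof
    fix q assume "q \<in> fiber p"
    then obtain t where t: "q = pos p t" using fiber_pos by blast
    then have "q = pos p (min t (top_pos p))" using pos_beyond[of t] by (simp add: min_def)
    then show "q \<in> pos p ` {..top_pos p}" by simp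
  qed
qed (use pos_fiber in blast)

lemma top_unique:
  assumes "q \<in> fiber p" "q x = None" shows "q = pos p (top_pos p)"
proof -
  obtain t where t: "q = pos p t" "t \<le> top_pos p" using assms fiber_eq by auto
  then have "\<not> t < top_pos p" using below_top[of t] assms(2) by (metis option.distinct(1))
  then show ?thesis using t by simp
qed

end

definition sweep :: "forest \<Rightarrow> forest list" where
  "sweep p = map (pos p) [0..<Suc (top_pos p)]"

end

section \<open>The zigzag structure of Algorithm R\<close>

\<comment> \<open>The locale constants below take \<open>{1..n}\<close> as an argument, which must not be rewritten.\<close>
declare One_nat_def [simp del]

context simplicial_vertex
begin

section \<open>Paths and components without the simplicial vertex\<close>

lemma reach_without:
  assumes X: "X \<subseteq> V" "x \<in> X" and uw: "(u, w) \<in> (edges_on E X)\<^sup>*" and u: "u \<noteq> x" and w: "w \<noteq> x"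
  shows "(u, w) \<in> (edges_on E (X - {x}))\<^sup>*"
proof -
  \<comment> \<open>The invariant for a path standing at \<open>x\<close> is that all neighbours of
    \<open>x\<close> are already reachable without it: the predecessor of \<open>x\<close> on the
    path is adjacent to each of them or equal to it.\<close>
  let ?R = "(edges_on E (X - {x}))\<^sup>*"
  have "(w \<noteq> x \<longrightarrow> (u, w) \<in> ?R) \<and> (w = x \<longrightarrow> (\<forall>z\<in>X - {x}. {z, x} \<in> E \<longrightarrow> (u, z) \<in> ?R))"
    using uw
  proof (induction rule: rtrancl_induct)
    case base
    then show ?case using u by simp
  next
    case (step y z)
    have yz: "y \<in> X" "z \<in> X" "{y, z} \<in> E" using step(2) by (auto simp: edges_on_def)
    consider "y = x" "z = x" | "y = x" "z \<noteq> x" | "y \<noteq> x" "z = x" | "y \<noteq> x" "z \<noteq> x" by blast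
    then show ?case
    proof cases
      case 3
      have "(u, v) \<in> ?R" if v: "v \<in> X - {x}" "{v, x} \<in> E" for v
      proof (cases "v = y")
        case False
        then have "{y, v} \<in> E" using nbrs_adjacent[of y v] v yz 3 X by blast
        then have "(y, v) \<in> edges_on E (X - {x})" using v yz 3 by (auto simp: edges_on_def)
        then show ?thesis using step 3 by (meson rtrancl.rtrancl_into_rtrancl)
      qed (use step 3 in simp)
      then show ?thesis using 3 by blast
    next
      case 4
      then have "(y, z) \<in> edges_on E (X - {x})" using yz by (auto simp: edges_on_def)
      then show ?thesis using step 4 by (meson rtrancl.rtrancl_into_rtrancl)
    qed (use step yz in \<open>auto simp: insert_commute\<close>)
  qed
  then show ?thesis using w by blast
qed

lemma connected_on_without:
  assumes "X \<subseteq> V" "x \<in> X" "connected_on E X" "X - {x} \<noteq> {}"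
  shows "connected_on E (X - {x})"
  using assms reach_without[OF assms(1,2)] by (auto simp: connected_on_def)

lemma component_without:
  assumes "X \<subseteq> V" "x \<in> X" "a \<noteq> x"
  shows "component E (X - {x}) a = component E X a - {x}"
proof -
  have "(edges_on E (X - {x}))\<^sup>* \<subseteq> (edges_on E X)\<^sup>*"
    by (rule rtrancl_mono) (auto simp: edges_on_def)
  then show ?thesis using reach_without[OF assms(1,2) _ assms(3)] by (auto simp: component_def)
qed

text \<open>Deleting a simplicial vertex does not split components, so removing it last makes it a
  leaf and leaves all other parents unchanged. Hence the initial forest of a prefix has its last
  vertex at the bottom.\<close>

lemma forest_of_order_snoc:
  assumes "set (ys @ [x]) = X" "distinct (ys @ [x])" "X \<subseteq> V"
  shows "forest_of_order E X (ys @ [x]) v \<noteq> Some x \<and>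
    (v \<noteq> x \<longrightarrow> forest_of_order E X (ys @ [x]) v = forest_of_order E (X - {x}) ys v)"
  using assms
proof (induction ys arbitrary: X v)
  case Nil
  then show ?case by (auto simp: component_def)
next
  case (Cons a ys)
  have a: "a \<noteq> x" "x \<in> X" using Cons.prems by auto
  have IH: "forest_of_order E (X - {a}) (ys @ [x]) v \<noteq> Some x \<and> (v \<noteq> x \<longrightarrow>
      forest_of_order E (X - {a}) (ys @ [x]) v = forest_of_order E (X - {a} - {x}) ys v)"
    using Cons.prems by (intro Cons.IH) auto
  define q p where "q = forest_of_order E (X - {a}) (ys @ [x])"
    and "p = forest_of_order E (X - {x} - {a}) ys"
  have "X - {x} - {a} = X - {a} - {x}" by blast
  then have qp: "q v \<noteq> Some x \<and> (v \<noteq> x \<longrightarrow> q v = p v)" using IH unfolding q_def p_def by metis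
  have "forest_of_order E X ((a # ys) @ [x]) v
      = (if v \<in> component E X a - {a} \<and> q v = None then Some a else q v)"
    by (simp add: q_def Let_def)
  moreover have "forest_of_order E (X - {x}) (a # ys) v
      = (if v \<in> component E X a - {x} - {a} \<and> p v = None then Some a else p v)"
    by (simp add: p_def Let_def component_without[OF Cons.prems(3) a(2,1)])
  ultimately show ?case using qp a(1)
    by (cases "v = x") (auto simp del: forest_of_order.simps)
qed

lemma sweep_props:
  assumes P: "elim_map E (V - {x}) p"
  shows "set (sweep p) = fiber p" "sweep p \<noteq> []" "hd (sweep p) = bottom p"
    "last (sweep p) = pos p (top_pos p)" "length (sweep p) = Suc (top_pos p)"
proof -
  have "set [0..<Suc (top_pos p)] = {..top_pos p}" by auto
  then show "set (sweep p) = fiber p" by (simp only: sweep_def fiber_eq[OF P] set_map)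
  show "hd (sweep p) = bottom p" by (simp add: sweep_def upt_conv_Cons del: upt_Suc)
qed (simp_all add: sweep_def)

text \<open>The flag tells whether the next sweep goes upwards. If \<open>ps\<close> is the run on
  the graph without its last vertex, this is the run on the whole graph.\<close>

primrec zigzag :: "bool \<Rightarrow> forest list \<Rightarrow> forest list" where
  "zigzag b [] = []"
| "zigzag b (p # ps) = (if b then sweep p else rev (sweep p)) @ zigzag (\<not> b) ps"

lemma zigzag_snoc:
  "zigzag b (ps @ [p]) = zigzag b ps @ (if b = even (length ps) then sweep p else rev (sweep p))"
  by (induction ps arbitrary: b) auto

lemma set_zigzag:
  assumes "\<forall>p\<in>set ps. elim_map E (V - {x}) p"
  shows "set (zigzag b ps) = {q. elim_map E V q \<and> del q \<in> set ps}"
  using assms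
proof (induction ps arbitrary: b)
  case (Cons p ps)
  then show ?case using sweep_props(1)[of p] by (auto simp: fiber_def)
qed simp

lemma zigzag_ends:
  assumes "\<forall>p\<in>set ps. elim_map E (V - {x}) p" "ps \<noteq> []"
  shows "hd (zigzag True ps) = bottom (hd ps)"
    "last (zigzag True ps) =
      (if odd (length ps) then pos (last ps) (top_pos (last ps)) else bottom (last ps))"
proof -
  show "hd (zigzag True ps) = bottom (hd ps)"
    using assms sweep_props[of "hd ps"] by (cases ps) auto
  obtain rs r where r: "ps = rs @ [r]" using assms(2) by (metis append_butlast_last_id)
  then show "last (zigzag True ps) =
      (if odd (length ps) then pos (last ps) (top_pos (last ps)) else bottom (last ps))"
    using assms sweep_props[of r] by (simp add: zigzag_snoc last_rev)
qed

end

section \<open>Sweeps as runs of Algorithm R\<close>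

lemma new_edges_iff:
  "i \<in> new_edges E Fs j \<longleftrightarrow> i < j \<and> (last Fs j = Some i \<and> rotate_edge E (last Fs) i j \<notin> set Fs \<or>
     last Fs i = Some j \<and> rotate_edge E (last Fs) j i \<notin> set Fs)"
  by (auto simp: new_edges_def new_move_def up_rotation_def down_rotation_def)

lemma new_edges_outside:
  assumes "elim_map E V (last Fs)" "j \<notin> V" shows "new_edges E Fs j = {}"
  using elim_mapD(2,3)[OF assms(1)] assms(2) by (auto simp: new_edges_iff)

locale last_simplicial = simplicial_vertex E "{1..Suc m}" "Suc m" for E m
begin

abbreviation "n \<equiv> Suc m"

lemma minus_last: "{1..n} - {n} = {1..m}"
  by auto

lemma initial_forest_bottom: "initial_forest n E = bottom (initial_forest m E)"
proof (rule bottom_eqI[symmetric])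
  let ?q = "initial_forest n E"
  have q: "?q v \<noteq> Some n \<and> (v \<noteq> n \<longrightarrow> ?q v = initial_forest m E v)" for v
  proof -
    have "[1..<Suc n] = [1..<Suc m] @ [n]" by simp
    moreover have "forest_of_order E {1..n} ([1..<Suc m] @ [n]) v \<noteq> Some n \<and> (v \<noteq> n \<longrightarrow>
      forest_of_order E {1..n} ([1..<Suc m] @ [n]) v = forest_of_order E ({1..n} - {n}) [1..<Suc m] v)"
      by (rule forest_of_order_snoc) auto
    ultimately show ?thesis unfolding initial_forest_def minus_last by metis
  qed
  have "initial_forest m E n = None" using initial_elim_forest[of E m] by (simp add: elim_forest_def)
  then have "del ?q v = initial_forest m E v" for v using q[of v] by (auto simp: del_vertex_def)
  then have "del ?q = initial_forest m E" ..
  then show "?q \<in> fiber (initial_forest m E)"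
    using elim_forest_imp_elim_map[OF initial_elim_forest] by (simp add: fiber_def)
  show "at_bottom ?q" using q by (simp add: at_bottom_def)
qed

context
  fixes p assumes P: "elim_map E {1..m} p"
begin

private lemmas P' = P[folded minus_last]

lemma less_last: "pos p t n = Some i \<Longrightarrow> i < n" "pos p t i = Some n \<Longrightarrow> i < n"
proof -
  note M = pos_elim_map[OF P', of t]
  show "i < n" if "pos p t n = Some i"
    using elim_mapD(3)[OF M that] acyc_neq[OF elim_mapD(1)[OF M] that] by simp
  show "i < n" if "pos p t i = Some n"
    using elim_mapD(2)[OF M that] acyc_neq[OF elim_mapD(1)[OF M] that] by simp
qed

lemma new_edges_beyond: "last Fs = pos p t \<Longrightarrow> k > n \<Longrightarrow> new_edges E Fs k = {}"
  using new_edges_outside[of E "{1..n}" Fs k] pos_elim_map[OF P', of t] by simp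

text \<open>As the largest vertex, \<open>n\<close> has priority. The edge to its only child, if
  any, leads back to the previous, visited position, so the edge to its parent is the unique
  choice.\<close>

lemma step_up:
  assumes l: "last Fs = pos p t" and t: "t < top_pos p" and new: "pos p (Suc t) \<notin> set Fs"
    and old: "\<And>s. t = Suc s \<Longrightarrow> pos p s \<in> set Fs"
  shows "algR_step E Fs (pos p (Suc t))"
proof -
  obtain y where y: "pos p t n = Some y" using below_top[OF P' t] by blast
  have r: "rotate_edge E (pos p t) y n = pos p (Suc t)" by (rule pos_step_up[OF P' t y])
  have yn: "y < n" by (rule less_last(1)[OF y])
  have down: "rotate_edge E (pos p t) n i \<in> set Fs" if "pos p t i = Some n" for i
    using pos_step_down[OF P' less_imp_le[OF t] that] old by auto
  have "new_edges E Fs n = {y}" using down y yn new by (auto simp: new_edges_iff l r)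
  moreover have "new_move E Fs y n (pos p (Suc t))"
    using y yn new r l by (simp add: new_move_def up_rotation_def)
  ultimately show ?thesis using new_edges_beyond[OF l] unfolding algR_step_def by blast
qed

lemma step_down:
  assumes l: "last Fs = pos p (Suc t)" and t: "t < top_pos p" and new: "pos p t \<notin> set Fs"
    and old: "Suc t < top_pos p \<Longrightarrow> pos p (Suc (Suc t)) \<in> set Fs"
  shows "algR_step E Fs (pos p t)"
proof -
  obtain c where c: "pos p (Suc t) c = Some n" using pos_has_child[OF P' t] by blast
  have r: "rotate_edge E (pos p (Suc t)) n c = pos p t"
    using pos_step_down[OF P' _ c] t by auto
  have cn: "c < n" by (rule less_last(2)[OF c])
  have only: "i = c" if "pos p (Suc t) i = Some n" for i
    using only_child[OF pos_elim_map[OF P'] that c] .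
  have up: "rotate_edge E (pos p (Suc t)) i n \<in> set Fs" if i: "pos p (Suc t) n = Some i" for i
  proof -
    have "Suc t \<noteq> top_pos p" using i top_pos[OF P'] by (metis option.distinct(1))
    then have "Suc t < top_pos p" using t by simp
    then show ?thesis using pos_step_up[OF P' _ i] old by simp
  qed
  have "new_edges E Fs n = {c}"
    using up only c cn new unfolding set_eq_iff new_edges_iff l r by (metis r singleton_iff)
  moreover have "new_move E Fs c n (pos p t)"
    using c cn new r l by (simp add: new_move_def down_rotation_def)
  ultimately show ?thesis using new_edges_beyond[OF l] unfolding algR_step_def by blast
qed

text \<open>Since \<open>Gs\<close> avoids the fiber, the visited members of the fiber are just the
  positions swept so far, and \<open>step_up\<close> applies until the top.\<close>

lemma visits_sweep_up:
  assumes v: "algR_visits n E (Gs @ [bottom p])" and G: "set Gs \<inter> fiber p = {}" and t: "t \<le> top_pos p"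
  shows "algR_visits n E (Gs @ map (pos p) [0..<Suc t])"
  using t
proof (induction t)
  case 0
  then show ?case using v by simp
next
  case (Suc t)
  let ?Fs = "Gs @ map (pos p) [0..<Suc t]"
  have "pos p (Suc t) \<notin> set Gs" using G pos_fiber[OF P', of "Suc t"] by blast
  moreover have "pos p (Suc t) \<noteq> pos p s" if "s \<in> set [0..<Suc t]" for s
    using pos_neq[OF P' _ Suc.prems, of s] that by (metis atLeastLessThan_iff atLeastLessThan_upt)
  ultimately have "pos p (Suc t) \<notin> set ?Fs" by (auto simp del: pos_simps upt_Suc set_upt)
  then have "algR_step E ?Fs (pos p (Suc t))"
    using Suc.prems by (intro step_up) (auto simp del: pos_simps)
  then have "algR_visits n E (?Fs @ [pos p (Suc t)])" using Suc by (intro algR_visits.step) auto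
  then show ?case by (simp del: pos_simps)
qed

lemma visits_sweep_down:
  assumes v: "algR_visits n E (Gs @ [pos p (top_pos p)])" and G: "set Gs \<inter> fiber p = {}"
    and t: "t \<le> top_pos p"
  shows "algR_visits n E (Gs @ rev (map (pos p) [t..<Suc (top_pos p)]))"
  using t
proof (induction t rule: inc_induct)
  case base
  then show ?case using v by simp
next
  case (step t)
  let ?Fs = "Gs @ rev (map (pos p) [Suc t..<Suc (top_pos p)])"
  have 1: "[Suc t..<Suc (top_pos p)] = Suc t # [Suc (Suc t)..<Suc (top_pos p)]"
    using step.hyps by (simp add: upt_conv_Cons)
  have 2: "[t..<Suc (top_pos p)] = t # [Suc t..<Suc (top_pos p)]"
    using step.hyps by (simp add: upt_conv_Cons)
  have new: "pos p t \<notin> set ?Fs"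
  proof
    assume "pos p t \<in> set ?Fs"
    moreover have "pos p t \<notin> set Gs" using G pos_fiber[OF P', of t] by blast
    ultimately have "pos p t \<in> pos p ` set [Suc t..<Suc (top_pos p)]" by (simp del: upt_Suc set_upt)
    then obtain s where "s \<in> set [Suc t..<Suc (top_pos p)]" "pos p t = pos p s" by blast
    moreover from this(1) have "t < s \<and> s \<le> top_pos p" by auto
    ultimately show False using pos_neq[OF P', of t s] by blast
  qed
  have l: "last ?Fs = pos p (Suc t)" unfolding 1 by simp
  have old: "pos p (Suc (Suc t)) \<in> set ?Fs" if "Suc t < top_pos p"
  proof -
    have "Suc (Suc t) \<in> set [Suc t..<Suc (top_pos p)]" using that by auto
    then show ?thesis by (simp del: upt_Suc set_upt pos_simps)
  qed
  have "algR_step E ?Fs (pos p t)" by (rule step_down[OF l step.hyps(2) new old])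
  then have "algR_visits n E (?Fs @ [pos p t])" using step by (intro algR_visits.step) auto
  then show ?case unfolding 2 by simp
qed

end

text \<open>At the end of a sweep the fiber is exhausted and \<open>n\<close> cannot move. Rotations
  of other edges commute with deleting \<open>n\<close>, and their results are unvisited exactly
  when the projections are. Algorithm R thus copies the step of the shorter run, with
  \<open>n\<close> still at the same end.\<close>

lemma zigzag_step:
  assumes Ps: "\<forall>p\<in>set Ps. elim_map E {1..m} p" "Ps \<noteq> []" and step: "algR_step E Ps p"
  shows "algR_step E (zigzag True Ps) (if odd (length Ps) then pos p (top_pos p) else bottom p)"
proof -
  note Ps' = Ps(1)[folded minus_last]
  let ?F = "zigzag True Ps"
  define e where "e = last ?F"
  define p0 where "p0 = last Ps"
  have p0: "elim_map E {1..m} p0" "p0 \<in> set Ps" using Ps by (auto simp: p0_def)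
  note p0' = p0(1)[folded minus_last]
  have e_eq: "e = (if odd (length Ps) then pos p0 (top_pos p0) else bottom p0)"
    unfolding e_def p0_def by (rule zigzag_ends(2)[OF Ps' Ps(2)])
  have e_fib: "e \<in> fiber p0" using e_eq pos_fiber[OF p0'] bottom(1)[OF p0'] by auto
  then have eM: "elim_map E {1..n} e" and del_e: "del e = p0" by (auto simp: fiber_def)
  have ends: "if odd (length Ps) then e n = None else at_bottom e"
    using e_eq top_pos[OF p0'] bottom(2)[OF p0'] by auto
  have visited: "q \<in> set ?F \<longleftrightarrow> del q \<in> set Ps" if "elim_map E {1..n} q" for q
    using set_zigzag[OF Ps'] that by auto
  \<comment> \<open>Since \<open>n\<close> is a root or a leaf, deleting it creates no edge between
    two other vertices.\<close>
  have edge: "e j = Some i \<longleftrightarrow> p0 j = Some i" if "i \<noteq> n" "j \<noteq> n" for i j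
  proof -
    have "p0 j = (if e j = Some n then e n else e j)"
      unfolding del_e[symmetric] using that by (simp add: del_vertex_def)
    moreover have "e n = None \<or> e j \<noteq> Some n" using ends by (auto simp: at_bottom_def split: if_splits)
    ultimately show ?thesis using that by auto
  qed
  have rot: "elim_map E {1..n} (rotate_edge E e i j)" "del (rotate_edge E e i j) = rotate_edge E p0 i j"
    if ij: "p0 j = Some i" "i \<noteq> n" "j \<noteq> n" for i j
  proof -
    have ej: "e j = Some i" using edge ij by blast
    show "elim_map E {1..n} (rotate_edge E e i j)" by (rule rotate_elim_map[OF fin eM ej])
    show "del (rotate_edge E e i j) = rotate_edge E p0 i j"
      using del_rotate[OF eM ej ij(2,3)] del_e by simp
  qed
  have same: "new_edges E ?F j = new_edges E Ps j" if "j < n" for j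
  proof (rule set_eqI)
    fix i
    show "i \<in> new_edges E ?F j \<longleftrightarrow> i \<in> new_edges E Ps j"
    proof (cases "i < j")
      case True
      then have ij: "i \<noteq> n" "j \<noteq> n" using \<open>j < n\<close> by auto
      have 1: "rotate_edge E e i j \<in> set ?F \<longleftrightarrow> rotate_edge E p0 i j \<in> set Ps" if "p0 j = Some i"
        using visited[OF rot(1)[OF that ij]] rot(2)[OF that ij] by simp
      have 2: "rotate_edge E e j i \<in> set ?F \<longleftrightarrow> rotate_edge E p0 j i \<in> set Ps" if "p0 i = Some j"
        using visited[OF rot(1)[OF that ij(2,1)]] rot(2)[OF that ij(2,1)] by simp
      show ?thesis
        using edge[OF ij] edge[OF ij(2,1)] 1 2
        unfolding new_edges_iff e_def[symmetric] p0_def[symmetric] by blast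
    qed (simp add: new_edges_iff)
  qed
  \<comment> \<open>Rotations of \<open>n\<close> stay in the fiber of \<open>p0\<close>, all of
    which has been visited.\<close>
  have last: "new_edges E ?F n = {}"
  proof -
    have "rotate_edge E e i n \<in> set ?F" if "e n = Some i" for i
      using visited[OF rotate_elim_map[OF fin eM that]] del_rotate_up[OF eM that] del_e p0 by simp
    moreover have "rotate_edge E e n i \<in> set ?F" if "e i = Some n" for i
      using visited[OF rotate_elim_map[OF fin eM that]] del_rotate_down[OF eM that] del_e p0 by simp
    ultimately show ?thesis by (auto simp: new_edges_iff e_def[symmetric])
  qed
  have beyond: "new_edges E ?F k = {}" if "k > n" for k
    using new_edges_outside[of E "{1..n}" ?F k] eM that by (simp add: e_def)
  obtain i j where ij: "\<forall>k>j. new_edges E Ps k = {}" "new_edges E Ps j = {i}" "new_move E Ps i j p"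
    using step by (auto simp: algR_step_def)
  have "j \<in> {1..m}" using new_edges_outside[of E "{1..m}" Ps j] ij(2) p0(1) unfolding p0_def by blast
  then have jn: "j < n" by simp
  have new: "p \<notin> set Ps" using ij(3) by (simp add: new_move_def)
  have ilj: "i < j" using ij(3) by (auto simp: new_move_def up_rotation_def down_rotation_def)
  obtain q where q: "q \<in> fiber p" "new_move E ?F i j q" "if odd (length Ps) then q n = None else at_bottom q"
  proof -
    have ends_rot: "if odd (length Ps) then rotate_edge E e a b n = None else at_bottom (rotate_edge E e a b)"
      if "a \<noteq> n" "b \<noteq> n" for a b
      using ends that unfolding rotate_edge_def at_bottom_def by (auto split: if_splits)
    consider "p0 j = Some i" "p = rotate_edge E p0 i j" | "p0 i = Some j" "p = rotate_edge E p0 j i"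
      using ij(3) by (auto simp: new_move_def up_rotation_def down_rotation_def p0_def)
    then show thesis
    proof cases
      case 1
      show thesis
      proof (rule that[of "rotate_edge E e i j"])
        show "rotate_edge E e i j \<in> fiber p" using rot[OF 1(1)] 1 ilj jn by (simp add: fiber_def)
        show "new_move E ?F i j (rotate_edge E e i j)"
          unfolding new_move_def up_rotation_def e_def[symmetric]
          using edge[of i j] 1 ilj jn visited[OF rot(1)[OF 1(1)]] rot(2)[OF 1(1)] new by auto
      qed (use ends_rot ilj jn in auto)
    next
      case 2
      show thesis
      proof (rule that[of "rotate_edge E e j i"])
        show "rotate_edge E e j i \<in> fiber p" using rot[OF 2(1)] 2 ilj jn by (simp add: fiber_def)
        show "new_move E ?F i j (rotate_edge E e j i)"
          unfolding new_move_def down_rotation_def e_def[symmetric]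
          using edge[of j i] 2 ilj jn visited[OF rot(1)[OF 2(1)]] rot(2)[OF 2(1)] new by auto
      qed (use ends_rot ilj jn in auto)
    qed
  qed
  have pM: "elim_map E ({1..n} - {n}) p" using q(1) del_elim_map by (auto simp: fiber_def)
  have "q = (if odd (length Ps) then pos p (top_pos p) else bottom p)"
    using top_unique[OF pM q(1)] bottom_eqI[OF q(1)] q(3) by (auto split: if_splits)
  moreover have "\<forall>k>j. new_edges E ?F k = {}"
  proof (intro allI impI)
    fix k assume "j < k"
    then show "new_edges E ?F k = {}"
      using same[of k] last beyond[of k] ij(1) by (cases k n rule: linorder_cases) auto
  qed
  moreover have "new_edges E ?F j = {i}" using same[OF jn] ij(2) by simp
  ultimately show ?thesis using q(2) unfolding algR_step_def by blast
qed

text \<open>Each step of the shorter run becomes one copied rotation followed by a full sweep,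
  downwards if an odd number of fibers has been swept before and upwards otherwise.\<close>

lemma visits_zigzag:
  assumes "algR_visits m E Ps" shows "algR_visits n E (zigzag True Ps)"
  using assms
proof (induction rule: algR_visits.induct)
  case init
  have P: "elim_map E {1..m} (initial_forest m E)"
    using elim_forest_imp_elim_map[OF initial_elim_forest] .
  have "algR_visits n E ([] @ [bottom (initial_forest m E)])"
    using algR_visits.init[of n E] initial_forest_bottom by simp
  from visits_sweep_up[OF P this, of "top_pos (initial_forest m E)"] show ?case by (simp add: sweep_def)
next
  case (step Ps p)
  note props = algR_visits_elim_forest[OF step(1)] algR_visits_elim_forest[OF algR_visits.step[OF step(1,2)]]
  have Ps: "\<forall>p\<in>set Ps. elim_map E {1..m} p" "Ps \<noteq> []" and p: "elim_map E {1..m} p" "p \<notin> set Ps"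
    using props elim_forest_imp_elim_map by auto
  let ?e = "if odd (length Ps) then pos p (top_pos p) else bottom p"
  have v: "algR_visits n E (zigzag True Ps @ [?e])"
    using algR_visits.step[OF step.IH zigzag_step[OF Ps step(2)]] .
  have disj: "set (zigzag True Ps) \<inter> fiber p = {}"
    using set_zigzag[OF Ps(1)[folded minus_last]] p by (auto simp: fiber_def)
  show ?case
  proof (cases "odd (length Ps)")
    case True
    then show ?thesis using visits_sweep_down[OF p(1) _ disj, of 0] v by (simp add: zigzag_snoc sweep_def)
  next
    case False
    then show ?thesis using visits_sweep_up[OF p(1) _ disj, of "top_pos p"] v
      by (simp add: zigzag_snoc sweep_def)
  qed
qed

lemma set_zigzag_all:
  assumes "set Ps = {p. elim_map E {1..m} p}"
  shows "set (zigzag b Ps) = {q. elim_map E {1..n} q}"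
  using set_zigzag[of Ps b] assms del_elim_map unfolding minus_last by auto

end

section \<open>Completeness of the runs on all prefixes\<close>

lemma algR_sequence_all:
  assumes v: "algR_visits n E Fs" and all: "set Fs = {q. elim_map E {1..n} q}"
  shows "algR_sequence n E Fs"
  unfolding algR_sequence_def
proof (intro conjI notI v)
  assume "\<exists>q. algR_step E Fs q"
  then obtain q where q: "algR_step E Fs q" by blast
  have "elim_map E {1..n} q" "q \<notin> set Fs"
    using algR_visits_elim_forest[OF algR_visits.step[OF v q]] elim_forest_imp_elim_map by auto
  then show False using all by blast
qed

context last_simplicial
begin

lemma sequence_zigzag:
  assumes "algR_sequence m E Ps" "set Ps = {p. elim_map E {1..m} p}" "algR_sequence n E Fs"
  shows "Fs = zigzag True Ps"
proof -
  have "algR_sequence n E (zigzag True Ps)"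
    using assms by (intro algR_sequence_all set_zigzag_all visits_zigzag) (simp_all add: algR_sequence_def)
  then show ?thesis using assms(3) algR_sequence_ex1 by blast
qed

lemma sequence_ends:
  assumes Ps: "algR_sequence m E Ps" "set Ps = {p. elim_map E {1..m} p}" and Fs: "algR_sequence n E Fs"
  shows "hd Fs = bottom (hd Ps)"
    "last Fs = (if odd (length Ps) then pos (last Ps) (top_pos (last Ps)) else bottom (last Ps))"
    "elim_map E {1..m} (hd Ps)" "elim_map E {1..m} (last Ps)"
proof -
  have ne: "Ps \<noteq> []" using algR_visits_elim_forest Ps by (auto simp: algR_sequence_def)
  have "\<forall>p\<in>set Ps. elim_map E ({1..n} - {n}) p" unfolding minus_last using Ps(2) by blast
  from zigzag_ends[OF this ne] show "hd Fs = bottom (hd Ps)"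
    "last Fs = (if odd (length Ps) then pos (last Ps) (top_pos (last Ps)) else bottom (last Ps))"
    unfolding sequence_zigzag[OF assms] by blast+
  show "elim_map E {1..m} (hd Ps)" "elim_map E {1..m} (last Ps)" using Ps(2) ne by auto
qed

end

lemma peo_last_simplicial:
  assumes "perfect_elimination_ordering n E" "Suc m \<le> n"
  shows "last_simplicial E m"
proof
  fix u w assume a: "u \<in> {1..Suc m}" "w \<in> {1..Suc m}" "u \<noteq> Suc m" "w \<noteq> Suc m" "u \<noteq> w"
    "{u, Suc m} \<in> E" "{w, Suc m} \<in> E"
  have "clique E (insert (Suc m) {u \<in> {1..n}. u < Suc m \<and> {u, Suc m} \<in> E})"
    using assms by (auto simp: perfect_elimination_ordering_def)
  then show "{u, w} \<in> E" using a assms(2) by (auto simp: clique_def)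
qed auto

text \<open>Induction on the prefix: the zigzag over a complete run meets every fiber, and every
  forest lies in the fiber of its projection.\<close>

theorem algR_sequence_complete:
  assumes "perfect_elimination_ordering n E" "k \<le> n" "algR_sequence k E Fs"
  shows "set Fs = {q. elim_map E {1..k} q}"
  using assms(2,3)
proof (induction k arbitrary: Fs)
  case 0
  have 1: "elim_map E {1..0} q \<longleftrightarrow> q = (\<lambda>v. None)" for q
  proof
    assume M: "elim_map E {1..0} q"
    have "q v = None" for v using elim_mapD(2)[OF M, of v] by (cases "q v") auto
    then show "q = (\<lambda>v. None)" ..
  qed (simp add: elim_map_def acyc_def)
  moreover have "initial_forest 0 E = (\<lambda>v. None)" by (simp add: initial_forest_def)
  ultimately have "algR_sequence 0 E [\<lambda>v. None]"
    using algR_visits.init[of 0 E] by (intro algR_sequence_all) auto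
  then have "Fs = [\<lambda>v. None]" using algR_sequence_ex1 0 by blast
  then show ?case using 1 by simp
next
  case (Suc k)
  interpret last_simplicial E k by (rule peo_last_simplicial[OF assms(1) Suc.prems(1)])
  obtain Ps where Ps: "algR_sequence k E Ps" using algR_sequence_ex1 by blast
  have all: "set Ps = {q. elim_map E {1..k} q}" using Suc.IH[OF _ Ps] Suc.prems by simp
  show ?case
    using sequence_zigzag[OF Ps all Suc.prems(2)] set_zigzag_all[OF all] by simp
qed

section \<open>Parity and the last forest\<close>

lemma even_card_involution:
  assumes "finite A" "\<And>a. a \<in> A \<Longrightarrow> f a \<in> A \<and> f (f a) = a \<and> f a \<noteq> a"
  shows "even (card A)"
  using assms
proof (induction A rule: finite_psubset_induct)
  case (psubset A)
  show ?case
  proof (cases "A = {}")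
    case False
    then obtain a where a: "a \<in> A" by blast
    let ?B = "A - {a, f a}"
    have f: "f a \<in> A" "f (f a) = a" "f a \<noteq> a" using psubset.prems[OF a] by auto
    have "f b \<in> ?B \<and> f (f b) = b \<and> f b \<noteq> b" if "b \<in> ?B" for b
      using psubset.prems[of b] that f by auto
    then have "even (card ?B)" using psubset.IH[of ?B] a by blast
    moreover have "card A = card ?B + 2"
      using card_Diff_subset[of "{a, f a}" A] card_mono[OF psubset.hyps(1), of "{a, f a}"] a f by simp
    ultimately show ?thesis by simp
  qed simp
qed

lemma elim_map_unique_root:
  assumes fin: "finite V" and M: "elim_map E V q" and con: "connected_on E V"
  obtains r where "r \<in> V" "q r = None" "V = subtree q r" "\<And>s. s \<in> V \<Longrightarrow> q s = None \<Longrightarrow> s = r"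
proof -
  obtain v where v: "v \<in> V" using con by (auto simp: connected_on_def)
  obtain r where r: "v \<in> subtree q r" "q r = None" using elim_map_root[OF fin M] by blast
  have rV: "r \<in> V" using r v elim_mapD(3)[OF M] by (metis subtree_childE)
  have "V \<subseteq> subtree q r"
    by (rule conn_sub[OF con order.refl]) (use elim_map_root_closed[OF M r(2) rV] v r in auto)
  then have V: "V = subtree q r" using elim_map_subtree_subset[OF M rV] by blast
  moreover have "s = r" if "s \<in> V" "q s = None" for s
    using that V by (metis option.distinct(1) subtree_upE)
  ultimately show thesis using that rV r by blast
qed

text \<open>The subtree of a child is closed under edges in the connected graph without
  \<open>r\<close>, so it fills that graph.\<close>

lemma elim_map_unique_child:
  assumes M: "elim_map E V q" and V: "V = subtree q r" and con: "connected_on E (V - {r})"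
  obtains c where "q c = Some r" "\<And>d. q d = Some r \<Longrightarrow> d = c"
proof -
  obtain v where v: "v \<in> V" "v \<noteq> r" using con by (auto simp: connected_on_def)
  obtain c where c: "q c = Some r" "v \<in> subtree q c" using v V by (metis subtree_childE)
  have sub: "V - {r} \<subseteq> subtree q c"
    by (rule conn_sub[OF con order.refl])
      (use elim_map_child_closed[OF M c(1)] V v c in auto)
  have "d = c" if d: "q d = Some r" for d
  proof -
    have "d \<in> V - {r}" using elim_mapD(2)[OF M d] acyc_neq[OF elim_mapD(1)[OF M] d] by simp
    then show ?thesis using sibling_subtrees_disjoint[OF elim_mapD(1)[OF M] d c(1)] sub subtree_refl by blast
  qed
  then show thesis using that c(1) by blast
qed

text \<open>If deleting any one vertex leaves a connected graph, then every elimination tree has a root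
  with a single child, and rotating the edge between them is an involution without fixed points.\<close>

lemma even_card_elim_maps:
  assumes fin: "finite V" and con: "connected_on E V" and con': "\<And>v. v \<in> V \<Longrightarrow> connected_on E (V - {v})"
  shows "even (card {q. elim_map E V q})"
proof (rule even_card_involution)
  have "{q. elim_map E V q} = {q. elim_forest E V q}" using elim_forest_iff_elim_map[OF fin] by blast
  then show "finite {q. elim_map E V q}" using finite_elim_forests[OF fin] by simp
  \<comment> \<open>The description is unique because the root and its only child are determined.
    After the rotation their roles are exchanged, so \<open>f\<close> then rotates back.\<close>
  define f where "f q = (THE q'. \<exists>r c. q r = None \<and> q c = Some r \<and> q' = rotate_edge E q r c)" for q
  have f: "f q = rotate_edge E q r c" if M: "elim_map E V q" and rc: "q r = None" "q c = Some r" for q r c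
  proof -
    obtain s where s: "V = subtree q s" "\<And>t. t \<in> V \<Longrightarrow> q t = None \<Longrightarrow> t = s" "s \<in> V"
      using elim_map_unique_root[OF fin M con] by metis
    obtain d where d: "\<And>e. q e = Some s \<Longrightarrow> e = d"
      using elim_map_unique_child[OF M s(1) con'[OF s(3)]] by metis
    have "t = s \<and> e = d" if "q t = None" "q e = Some t" for t e
      using s(2)[OF elim_mapD(3)[OF M that(2)] that(1)] d that by blast
    then show ?thesis unfolding f_def using rc by blast
  qed
  fix q assume "q \<in> {q. elim_map E V q}"
  then have M: "elim_map E V q" by simp
  obtain r where r: "r \<in> V" "q r = None" "V = subtree q r" using elim_map_unique_root[OF fin M con] by metis
  obtain c where c: "q c = Some r" using elim_map_unique_child[OF M r(3) con'[OF r(1)]] by metis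
  let ?q = "rotate_edge E q r c"
  have N: "elim_map E V ?q" by (rule rotate_elim_map[OF fin M c])
  have "r \<noteq> c" using acyc_neq[OF elim_mapD(1)[OF M] c] by simp
  then have q: "?q c = None" "?q r = Some c" using r by (simp_all add: rotate_edge_def)
  have fq: "f q = ?q" by (rule f[OF M r(2) c])
  have "f ?q = q" using f[OF N q] rotate_rotate[OF fin M c] by simp
  then show "f q \<in> {q. elim_map E V q} \<and> f (f q) = q \<and> f q \<noteq> q"
    using fq N q r by auto
qed

section \<open>Connectivity of prefixes of the ordering\<close>

lemma connected_on_nbr:
  assumes "connected_on E C" "x \<in> C" "y \<in> C" "y \<noteq> x"
  obtains u where "u \<in> C" "u \<noteq> x" "{u, x} \<in> E"
proof -
  have D: "component E (C - {x}) y \<in> components E (C - {x})" using assms by (intro component_in) auto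
  show thesis using components_adjacent[OF assms(1,2) D] that by (auto simp: component_def)
qed

text \<open>Downward induction from \<open>n\<close>: deleting the simplicial last vertex of a
  prefix keeps it connected.\<close>

lemma peo_connected_prefix:
  assumes peo: "perfect_elimination_ordering n E" and con: "connected_on E {1..n}" and k: "1 \<le> k" "k \<le> n"
  shows "connected_on E {1..k}"
  using k(2,1)
proof (induction k rule: inc_induct)
  case (step k)
  interpret last_simplicial E k using step.hyps by (intro peo_last_simplicial[OF peo]) simp
  have "{1..Suc k} - {Suc k} \<noteq> {}" unfolding minus_last using step.prems by simp
  then have "connected_on E ({1..Suc k} - {Suc k})"
    using step.IH step.prems by (intro connected_on_without) auto
  then show ?case unfolding minus_last .
qed (rule con)

lemma peo_biconnected_prefix:
  assumes peo: "perfect_elimination_ordering n E"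
    and con: "\<And>v. v \<in> {1..n} \<Longrightarrow> connected_on E ({1..n} - {v})" and k: "2 \<le> k" "k \<le> n"
  shows "\<forall>v\<in>{1..k}. connected_on E ({1..k} - {v})"
  using k(2,1)
proof (induction k rule: inc_induct)
  case (step k)
  interpret last_simplicial E k using step.hyps by (intro peo_last_simplicial[OF peo]) simp
  show ?case
  proof
    fix v assume v: "v \<in> {1..k}"
    have eq: "{1..Suc k} - {v} - {Suc k} = {1..k} - {v}" using v by auto
    \<comment> \<open>Since \<open>k\<close> is at least 2, some vertex remains, as connectedness
      requires.\<close>
    have "(if v = 1 then 2 else 1) \<in> {1..k} - {v}" using step.prems by auto
    then have "{1..Suc k} - {v} - {Suc k} \<noteq> {}" unfolding eq by blast
    moreover have "connected_on E ({1..Suc k} - {v})" using step.IH step.prems v by auto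
    ultimately have "connected_on E ({1..Suc k} - {v} - {Suc k})"
      using v by (intro connected_on_without) auto
    then show "connected_on E ({1..k} - {v})" unfolding eq .
  qed
qed (use con in blast)

section \<open>Positions over small forests\<close>

context simplicial_vertex
begin

lemma bottom_apply:
  assumes P: "elim_map E (V - {x}) p" and v: "v \<noteq> x" shows "bottom p v = p v"
proof -
  have "p = del (bottom p)" using bottom(1)[OF P] by (simp add: fiber_def)
  then have "p v = del (bottom p) v" by simp
  then show ?thesis using bottom(2)[OF P] v by (simp add: del_vertex_def at_bottom_def)
qed

lemma bottom_single_nbr:
  assumes P: "elim_map E (V - {x}) p" and d: "d \<in> V" "d \<noteq> x" "{d, x} \<in> E"
    and only: "\<And>u. u \<in> V \<Longrightarrow> u \<noteq> x \<Longrightarrow> {u, x} \<in> E \<Longrightarrow> u = d"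
  shows "bottom p x = Some d"
proof -
  let ?q = "bottom p"
  have M: "elim_map E V ?q" using bottom(1)[OF P] by (simp add: fiber_def)
  have st: "subtree ?q x = {x}" by (rule at_bottom_subtree[OF bottom(2)[OF P]])
  have "x \<in> subtree ?q d" using elim_mapD(4)[OF M d(1) xV d(3)] st d(2) by blast
  then obtain e where e: "?q x = Some e" using d(2) by (metis subtree_upE)
  have "{x, e} \<in> E" using elim_mapD(5)[OF M e] st by simp
  then have "e = d" using only[of e] elim_mapD(3)[OF M e] acyc_neq[OF elim_mapD(1)[OF M] e]
    by (simp add: insert_commute)
  then show ?thesis using e by simp
qed

lemma top_pos_nbr_root:
  assumes P: "elim_map E (V - {x}) p" and d: "bottom p x = Some d" "p d = None"
  shows "top_pos p = 1"
  unfolding top_pos_def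
proof (rule Least_equality)
  have "d \<noteq> x" using bottom(2)[OF P] d(1) by (auto simp: at_bottom_def)
  then have "bottom p d = None" using bottom_apply[OF P] d(2) by simp
  then show "pos p 1 x = None" using up_parent[of "bottom p" d] d(1) by (simp add: One_nat_def)
  fix t assume "pos p t x = None"
  then show "1 \<le> t" using d(1) by (cases t) auto
qed

text \<open>Starting below \<open>d\<close>, the vertex passes first \<open>d\<close> and then the
  root \<open>r\<close>, so the fiber has three members.\<close>

lemma top_pos_nbr_below_root:
  assumes P: "elim_map E (V - {x}) p" and d: "bottom p x = Some d" "p d = Some r" "p r = None"
  shows "top_pos p = 2"
  unfolding top_pos_def
proof (rule Least_equality)
  have dx: "d \<noteq> x" using bottom(2)[OF P] d(1) by (auto simp: at_bottom_def)
  have rx: "r \<noteq> x" using elim_mapD(3)[OF P d(2)] by simp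
  have rd: "r \<noteq> d" using d by auto
  have 1: "pos p 1 x = Some r"
    using up_parent[of "bottom p" d] d bottom_apply[OF P dx] by (simp add: One_nat_def)
  have "pos p 1 r = None"
    using d rx rd bottom_apply[OF P rx] by (simp add: One_nat_def up_def rotate_edge_def)
  then have "up (pos p 1) x = None" using up_parent[of "pos p 1" r, OF 1] by simp
  then show "pos p 2 x = None" using pos_simps(2)[of p 1] by (simp add: numeral_2_eq_2 One_nat_def)
  fix t assume t: "pos p t x = None"
  have "t \<noteq> 0" using t d(1) by (metis option.distinct(1) pos_simps(1))
  moreover have "t \<noteq> 1" using t 1 by auto
  ultimately show "2 \<le> t" by simp
qed

end

section \<open>First and last forests of successive prefixes\<close>

context last_simplicial
begin

lemma sequence_two:
  assumes m: "m = 1" and e: "{1, n} \<in> E" and Ps: "algR_sequence m E Ps" "set Ps = {p. elim_map E {1..m} p}"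
    and Fs: "algR_sequence n E Fs"
  shows "\<exists>a b. Fs = [a, b] \<and> a 1 = None \<and> a n = Some 1 \<and> b 1 = Some n \<and> b n = None \<and>
    b = rotate_edge E a 1 n"
proof -
  define p :: forest where "p = (\<lambda>v. None)"
  have n1: "n \<noteq> 1" using m by simp
  have "elim_map E {1..m} q \<longleftrightarrow> q = p" for q
  proof
    assume M: "elim_map E {1..m} q"
    have "q v = None" for v
      using elim_mapD(2,3)[OF M, of v] acyc_neq[OF elim_mapD(1)[OF M], of v] m by (cases "q v") auto
    then show "q = p" unfolding p_def ..
  next
    assume "q = p"
    then show "elim_map E {1..m} q" using m by (auto simp: elim_map_def acyc_def p_def)
  qed
  then have set: "set Ps = {p}" and P: "elim_map E {1..m} p" using Ps(2) by auto
  have "distinct Ps" using algR_visits_elim_forest Ps(1) by (auto simp: algR_sequence_def)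
  then have "length Ps = 1" using set distinct_card[of Ps] by simp
  then have "Ps = [p]" using set by (cases Ps) (auto simp: One_nat_def)
  note P' = P[folded minus_last]
  have bn: "bottom p n = Some 1"
  proof (rule bottom_single_nbr[OF P'])
    show "{1, n} \<in> E" by (rule e)
  qed (use m n1 in auto)
  have b1: "bottom p 1 = None" using bottom_apply[OF P', of 1] n1 by (simp add: p_def)
  have "top_pos p = 1" using top_pos_nbr_root[OF P' bn] by (simp add: p_def)
  moreover have "[0..<Suc 1] = [0, 1]" by (simp add: One_nat_def)
  moreover have "pos p 1 = up (bottom p)" by (metis One_nat_def pos_simps)
  ultimately have "sweep p = [bottom p, up (bottom p)]" by (simp only: sweep_def list.map pos_simps)
  then have "Fs = [bottom p, up (bottom p)]" using sequence_zigzag[OF Ps Fs] \<open>Ps = [p]\<close> by simp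
  moreover have "up (bottom p) = rotate_edge E (bottom p) 1 n" using bn by (simp add: up_def)
  moreover have "rotate_edge E (bottom p) 1 n 1 = Some n" "rotate_edge E (bottom p) 1 n n = None"
    using b1 n1 by (simp_all add: rotate_edge_def)
  ultimately show ?thesis using b1 bn by auto
qed

text \<open>After an even number of sweeps \<open>n\<close> is at the bottom in the last forest as
  in the first. Putting \<open>n\<close> at the bottom commutes with the given rotation, which does
  not involve \<open>n\<close>.\<close>

lemma even_rotation_step:
  assumes Ps: "algR_sequence m E Ps" "set Ps = {p. elim_map E {1..m} p}" and Fs: "algR_sequence n E Fs"
    and ev: "even (length Ps)" and rot: "differ_by_rotation E (hd Ps) (last Ps)"
  shows "differ_by_rotation E (hd Fs) (last Fs)"
proof -
  note ends = sequence_ends[OF Ps Fs]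
  note P' = ends(3)[folded minus_last]
  obtain i j where ij: "hd Ps j = Some i" "last Ps = rotate_edge E (hd Ps) i j"
    using rot by (auto simp: differ_by_rotation_def)
  have n: "i \<noteq> n" "j \<noteq> n" using elim_mapD(2,3)[OF ends(3) ij(1)] by auto
  let ?b = "bottom (hd Ps)"
  have M: "elim_map E {1..n} ?b" and d: "del ?b = hd Ps" using bottom(1)[OF P'] by (auto simp: fiber_def)
  have bj: "?b j = Some i" using bottom_apply[OF P' n(2)] ij by simp
  have "rotate_edge E ?b i j \<in> fiber (last Ps)"
    using rotate_elim_map[OF fin M bj] del_rotate[OF M bj n] d ij by (simp add: fiber_def)
  moreover have "at_bottom (rotate_edge E ?b i j)"
    using bottom(2)[OF P'] n by (auto simp: at_bottom_def rotate_edge_def)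
  ultimately have "bottom (last Ps) = rotate_edge E ?b i j" by (rule bottom_eqI)
  then show ?thesis using ends ev bj by (auto simp: differ_by_rotation_def)
qed

text \<open>The only neighbour \<open>d\<close> of \<open>n\<close> is the root in one of the two
  forests and the child of the root in the other, so the fibers have 2 and 3 members, in some
  order.\<close>

lemma sequence_three_odd:
  assumes Ps: "algR_sequence m E Ps" "set Ps = {p. elim_map E {1..m} p}" and Fs: "algR_sequence n E Fs"
    and m: "m = 2" and ab: "Ps = [a, b]" "a 1 = None" "a 2 = Some 1" "b 1 = Some 2" "b 2 = None"
    and d: "d = 1 \<or> d = 2" "{d, n} \<in> E" and only: "\<And>u. u \<in> {1..n} \<Longrightarrow> u \<noteq> n \<Longrightarrow> {u, n} \<in> E \<Longrightarrow> u = d"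
  shows "odd (length Fs)"
proof -
  have A: "elim_map E ({1..n} - {n}) a" and B: "elim_map E ({1..n} - {n}) b"
    unfolding minus_last using Ps(2) ab(1) by auto
  have dV: "d \<in> {1..n}" "d \<noteq> n" using d(1) m by auto
  have na: "bottom a n = Some d" by (rule bottom_single_nbr[OF A dV d(2) only])
  have nb: "bottom b n = Some d" by (rule bottom_single_nbr[OF B dV d(2) only])
  have "top_pos a + top_pos b = 3"
    using d(1)
  proof
    assume "d = 1"
    then show ?thesis using top_pos_nbr_root[OF A na] top_pos_nbr_below_root[OF B nb] ab by simp
  next
    assume "d = 2"
    then show ?thesis using top_pos_nbr_root[OF B nb] top_pos_nbr_below_root[OF A na] ab by simp
  qed
  \<comment> \<open>A sweep has one more entry than its top position, as positions count from
    0.\<close>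
  moreover have "length Fs = top_pos a + top_pos b + 2"
    using sequence_zigzag[OF Ps Fs] ab(1) sweep_props(5)[OF A] sweep_props(5)[OF B] by simp
  ultimately show ?thesis by simp
qed

text \<open>After an odd number of sweeps \<open>n\<close> is at the top. In a connected graph it is
  the only root, so the old root \<open>r\<close> now hangs below \<open>n\<close>.\<close>

lemma last_top_parents:
  assumes Ps: "algR_sequence m E Ps" "set Ps = {p. elim_map E {1..m} p}" and Fs: "algR_sequence n E Fs"
    and con: "connected_on E {1..n}" and od: "odd (length Ps)"
    and r: "last Ps r = None" "r \<in> {1..m}" and v: "last Ps v = Some r"
  shows "last Fs v = Some r" "last Fs r = Some n"
proof -
  note ends = sequence_ends[OF Ps Fs]
  note P' = ends(4)[folded minus_last]
  have L: "last Fs = pos (last Ps) (top_pos (last Ps))" using ends(2) od by simp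
  have top: "last Fs n = None" unfolding L by (rule top_pos[OF P'])
  have M: "elim_map E {1..n} (last Fs)" unfolding L by (rule pos_elim_map[OF P'])
  have "del (last Fs) = last Ps" unfolding L using pos_fiber[OF P'] by (simp add: fiber_def)
  then have d: "last Ps u = (if u = n then None else if last Fs u = Some n then None else last Fs u)" for u
    using top by (metis del_vertex_def)
  show "last Fs v = Some r" using d[of v] v by (auto split: if_splits)
  have "last Fs r = Some n \<or> last Fs r = None" using d[of r] r by (auto split: if_splits)
  moreover have "last Fs r \<noteq> None"
  proof
    assume a: "last Fs r = None"
    obtain s where s: "\<And>t. t \<in> {1..n} \<Longrightarrow> last Fs t = None \<Longrightarrow> t = s"
      using elim_map_unique_root[OF fin M con] by metis
    have "r \<in> {1..n}" "n \<in> {1..n}" using r(2) by auto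
    then show False using s[of r] s[of n] a top r(2) by auto
  qed
  ultimately show "last Fs r = Some n" by blast
qed

lemma last_even_parent:
  assumes Ps: "algR_sequence m E Ps" "set Ps = {p. elim_map E {1..m} p}" and Fs: "algR_sequence n E Fs"
    and "even (length Ps)" "v \<noteq> n"
  shows "last Fs v = last Ps v"
  using sequence_ends[OF Ps Fs] bottom_apply[of "last Ps" v] assms(4,5) unfolding minus_last by simp

text \<open>Inserting a vertex on a path never brings another vertex closer to the root.\<close>

lemma last_depth_two:
  assumes Ps: "algR_sequence m E Ps" "set Ps = {p. elim_map E {1..m} p}" and Fs: "algR_sequence n E Fs"
    and ab: "last Ps v = Some a" "last Ps a = Some b"
  shows "\<exists>a b. last Fs v = Some a \<and> last Fs a = Some b"
proof -
  note ends = sequence_ends[OF Ps Fs]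
  note P' = ends(4)[folded minus_last]
  have "last Fs \<in> fiber (last Ps)" using ends(2) pos_fiber[OF P'] bottom(1)[OF P'] by auto
  then have d: "last Ps u = (if u = n then None else if last Fs u = Some n then last Fs n else last Fs u)" for u
    unfolding fiber_def by (metis (mono_tags, lifting) del_vertex_def mem_Collect_eq)
  have "last Fs v = Some n \<and> last Fs n = Some a \<or> last Fs v = Some a"
    using d[of v] ab(1) by (metis option.distinct(1))
  moreover have "last Fs a \<noteq> None" using d[of a] ab(2) by (metis option.distinct(1))
  ultimately show ?thesis by auto
qed

end

lemma algR_sequence_length:
  assumes "perfect_elimination_ordering n E" "k \<le> n" "algR_sequence k E Fs"
  shows "length Fs = card {q. elim_map E {1..k} q}"
proof -
  have "distinct Fs" using algR_visits_elim_forest assms(3) by (auto simp: algR_sequence_def)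
  then show ?thesis using algR_sequence_complete[OF assms] distinct_card by metis
qed

lemma prefix_edge_one_two:
  assumes "connected_on E {1..2}" shows "{1, 2} \<in> E"
proof -
  obtain u where "u \<in> {1..2}" "u \<noteq> 2" "{u, 2} \<in> E"
    by (rule connected_on_nbr[OF assms, of 2 1]) auto
  moreover from this have "u = 1" by auto
  ultimately show ?thesis by simp
qed

lemma algR_sequence_two:
  assumes peo: "perfect_elimination_ordering n E" and n: "2 \<le> n" and e: "{1, 2} \<in> E"
    and Fs: "algR_sequence 2 E Fs"
  shows "\<exists>a b. Fs = [a, b] \<and> a 1 = None \<and> a 2 = Some 1 \<and> b 1 = Some 2 \<and> b 2 = None \<and>
    b = rotate_edge E a 1 2"
proof -
  obtain m where m: "m = (1 :: nat)" by blast
  have n2: "Suc m = 2" using m by simp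
  interpret last_simplicial E m by (rule peo_last_simplicial[OF peo]) (use n n2 in simp)
  obtain Ps where Ps: "algR_sequence m E Ps" using algR_sequence_ex1 by blast
  have "set Ps = {p. elim_map E {1..m} p}" using n m by (intro algR_sequence_complete[OF peo _ Ps]) simp
  from sequence_two[OF m _ Ps this] show ?thesis using e Fs unfolding n2 by blast
qed

section \<open>The 2-connected case\<close>

text \<open>The prefix \<open>{1..2}\<close> gives the rotation of the edge between 1 and 2. Each
  further vertex is added to a run of even length and so preserves a single rotation.\<close>

lemma biconnected_differ_by_rotation:
  assumes peo: "perfect_elimination_ordering n E" and n: "3 \<le> n"
    and con: "\<And>v. v \<in> {1..n} \<Longrightarrow> connected_on E ({1..n} - {v})"
    and k: "2 \<le> k" "k \<le> n" and Fs: "algR_sequence k E Fs"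
  shows "differ_by_rotation E (hd Fs) (last Fs)"
  using k Fs
proof (induction k arbitrary: Fs rule: dec_induct)
  \<comment> \<open>The prefix arises from the next one by deleting a single vertex, which is why
    \<open>k < n\<close> is assumed.\<close>
  have con': "connected_on E {1..k}" if "2 \<le> k" "k < n" for k
  proof -
    have eq: "{1..Suc k} - {Suc k} = {1..k}" by auto
    have "\<forall>v\<in>{1..Suc k}. connected_on E ({1..Suc k} - {v})"
      using that by (intro peo_biconnected_prefix[OF peo con]) simp_all
    then have "connected_on E ({1..Suc k} - {Suc k})" by (rule bspec) simp
    then show ?thesis unfolding eq .
  qed
  {
    case base
    obtain a b where "Fs = [a, b]" "a 2 = Some 1" "b = rotate_edge E a 1 2"
      using algR_sequence_two[OF peo _ prefix_edge_one_two[OF con'] base(2)] n by auto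
    then show ?case by (auto simp: differ_by_rotation_def)
  next
    case (step k)
    interpret last_simplicial E k by (rule peo_last_simplicial[OF peo step.prems(1)])
    obtain Ps where Ps: "algR_sequence k E Ps" using algR_sequence_ex1 by blast
    have k: "k \<le> n" using step.prems(1) by simp
    have "even (length Ps)"
      unfolding algR_sequence_length[OF peo k Ps]
    proof (rule even_card_elim_maps)
      show "connected_on E {1..k}" using con' step by simp
      show "connected_on E ({1..k} - {v})" if "v \<in> {1..k}" for v
        using peo_biconnected_prefix[OF peo con step.hyps(1) k] that by blast
    qed simp
    then show ?case
      using even_rotation_step[OF Ps algR_sequence_complete[OF peo k Ps] step.prems(2)] step.IH[OF k Ps]
      by blast
  }
qed

section \<open>The case of a tree\<close>

text \<open>In the last forests, 2 ends above 1, then 3 ends at the bottom after an even number of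
  sweeps, and 4 ends above 2 after an odd number. From then on 1 stays at least two levels below its
  root.\<close>

lemma tree_last_depth_two:
  assumes peo: "perfect_elimination_ordering n E" and con: "connected_on E {1..n}"
    and acyclic: "\<nexists>cs. cycle E cs" and k: "4 \<le> k" "k \<le> n" and Fs: "algR_sequence k E Fs"
  shows "\<exists>a b. last Fs 1 = Some a \<and> last Fs a = Some b"
  using k Fs
proof (induction k arbitrary: Fs rule: dec_induct)
  case base
  have con': "connected_on E {1..k}" if "1 \<le> k" "k \<le> 4" for k
    using peo_connected_prefix[OF peo con] that base by simp
  have e: "{1, 2} \<in> E" using prefix_edge_one_two con' by simp
  obtain Ps where Ps: "algR_sequence 2 E Ps" using algR_sequence_ex1 by blast
  have Ps_all: "set Ps = {p. elim_map E {1..2} p}" using base by (intro algR_sequence_complete[OF peo _ Ps]) simp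
  obtain Qs where Qs: "algR_sequence 3 E Qs" using algR_sequence_ex1 by blast
  have Qs_all: "set Qs = {p. elim_map E {1..3} p}" using base by (intro algR_sequence_complete[OF peo _ Qs]) simp
  obtain a b where ab: "Ps = [a, b]" "a 1 = None" "a 2 = Some 1" "b 1 = Some 2" "b 2 = None"
    using algR_sequence_two[OF peo _ e Ps] base by auto
  obtain d where d: "d \<in> {1..3}" "d \<noteq> 3" "{d, 3} \<in> E"
    by (rule connected_on_nbr[OF con'[of 3], of 3 1]) auto
  \<comment> \<open>Otherwise 1, 2, 3 would form a triangle. Together with connectivity, 3 has
    exactly one neighbour in its prefix.\<close>
  have "{1, 3} \<notin> E \<or> {2, 3} \<notin> E"
  proof (rule ccontr)
    assume "\<not> ?thesis"
    then have e': "{2, 3} \<in> E" "{3, 1} \<in> E" by (auto simp: insert_commute)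
    have "{[1, 2, 3] ! k, [1, 2, 3] ! (Suc k mod 3)} \<in> E" if k: "k < 3" for k :: nat
    proof -
      have "k = 0 \<or> k = 1 \<or> k = 2" using k by arith
      then consider "k = 0" | "k = 1" | "k = 2" by blast
      then show ?thesis using e e' by cases simp_all
    qed
    then have "cycle E [1, 2, 3]" by (simp add: cycle_def)
    then show False using acyclic by blast
  qed
  then have only: "u = d" if "u \<in> {1..3}" "u \<noteq> 3" "{u, 3} \<in> E" for u
  proof -
    have "u = 1 \<or> u = 2" "d = 1 \<or> d = 2" using that d by auto
    then show ?thesis using \<open>{1, 3} \<notin> E \<or> {2, 3} \<notin> E\<close> that(3) d(3) by metis
  qed
  have d12: "d = 1 \<or> d = 2" using d by auto
  have odd: "odd (length Qs)" and Q: "last Qs 1 = Some 2" "last Qs 2 = None"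
  proof -
    obtain m where m: "m = (2 :: nat)" by blast
    have m3: "Suc m = 3" using m by simp
    interpret last_simplicial E m by (rule peo_last_simplicial[OF peo]) (use base m3 in simp)
    note seqs = Ps[folded m] Ps_all[folded m] Qs[folded m3]
    show "odd (length Qs)"
      by (rule sequence_three_odd[OF seqs m ab d12]) (unfold m3, fact d(3), rule only)
    have "even (length Ps)" "1 \<noteq> Suc m" "2 \<noteq> Suc m" using ab(1) m by simp_all
    then have "last Qs 1 = b 1" "last Qs 2 = b 2" using last_even_parent[OF seqs] ab(1) by simp_all
    then show "last Qs 1 = Some 2" "last Qs 2 = None" using ab by simp_all
  qed
  obtain m where m: "m = (3 :: nat)" by blast
  have m4: "Suc m = 4" using m by simp
  interpret last_simplicial E m by (rule peo_last_simplicial[OF peo]) (use base m4 in simp)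
  have "connected_on E {1..Suc m}" using con' m4 by simp
  from last_top_parents[OF Qs[folded m] Qs_all[folded m] base(2)[folded m4] this odd Q(2) _ Q(1)]
  show ?case using m by auto
next
  case (step k)
  interpret last_simplicial E k by (rule peo_last_simplicial[OF peo step.prems(1)])
  have k: "k \<le> n" using step.prems(1) by simp
  obtain Ps where Ps: "algR_sequence k E Ps" using algR_sequence_ex1 by blast
  show ?case
    using last_depth_two[OF Ps algR_sequence_complete[OF peo k Ps] step.prems(2)] step.IH[OF k Ps] by blast
qed

lemma initial_forest_one: "1 \<le> n \<Longrightarrow> initial_forest n E 1 = None"
proof -
  assume "1 \<le> n"
  then have 1: "[1..<Suc n] = 1 # [2..<Suc n]"
    by (simp add: upt_conv_Cons numeral_2_eq_2 One_nat_def del: upt_Suc)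
  have "elim_forest E ({1..n} - {1}) (forest_of_order E ({1..n} - {1}) [2..<Suc n])"
    by (rule elim_forest_of_order) auto
  then have "forest_of_order E ({1..n} - {1}) [2..<Suc n] 1 = None" by (simp add: elim_forest_def)
  then show ?thesis unfolding initial_forest_def 1 by (simp add: Let_def del: upt_Suc)
qed

text \<open>A rotation moves a root down by at most one level.\<close>

lemma not_differ_by_rotation:
  assumes "p v = None" "q v = Some a" "q a = Some b"
  shows "\<not> differ_by_rotation E p q"
  using assms by (auto simp: differ_by_rotation_def rotate_edge_def split: if_splits)

theorem theorem3:
  fixes n :: nat and E :: "nat set set" and Fs :: "forest list"
  assumes "simple_graph {1..n} E"
    and "chordal E"
    and "perfect_elimination_ordering n E"
    and "algR_sequence n E Fs"
  shows "(two_connected {1..n} E \<longrightarrow> differ_by_rotation E (hd Fs) (last Fs)) \<and>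
         (tree {1..n} E \<and> n \<ge> 4 \<longrightarrow> \<not> differ_by_rotation E (hd Fs) (last Fs))"
proof (intro conjI impI)
  assume "two_connected {1..n} E"
  then show "differ_by_rotation E (hd Fs) (last Fs)"
    using assms by (intro biconnected_differ_by_rotation[of n E n]) (auto simp: two_connected_def)
next
  assume t: "tree {1..n} E \<and> n \<ge> 4"
  \<comment> \<open>Vertex 1 is the witness: a root of the first forest, but at depth at least two
    in the last.\<close>
  then obtain a b where "last Fs 1 = Some a" "last Fs a = Some b"
    using tree_last_depth_two[of n E n Fs] assms by (auto simp: tree_def)
  moreover have "hd Fs = initial_forest n E"
    using assms(4) algR_visits_elim_forest by (simp add: algR_sequence_def)
  then have "hd Fs 1 = None" using initial_forest_one t by simp
  ultimately show "\<not> differ_by_rotation E (hd Fs) (last Fs)" by (intro not_differ_by_rotation)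
qed

end
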